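(* Fix $\mu\ge0$. Assume that $R^L>0$, $R^R>0$ and $\mathcal Q=\operatorname{diag}(Q_\mu,Q)=D'D\ge0$ for some matrix $D$, and that $(\operatorname{diag}(A,A),\mathcal Q^{1/2})$ is observable and $(A,C)$ is detectable. If the system without additive noise $$x_{k+1}=Ax_k+BU_k+B^L\tilde u_k^L$$ is stabilizable in the mean-square sense, i.e. there exist stabilizing controllers of the form $U_k=-K_0\hat x^R_{k|k}-\bar K_0\mathbb E\hat x^R_{k|k}$, $\tilde u_k^L=-F_0(\hat x^L_{k|k}-\hat x^R_{k|k})$ with constant matrices $K_0,\bar K_0,F_0$, then the algebraic Riccati equations $$Z=A'ZA+Q_\mu-K'\Upsilon K,\quad X=A'\Theta A+Q_\mu-L'\Lambda^{-1}L,\quad S=A'SA-\mu Q+K'\Upsilon K-N'M^{-1}N$$ admit solutions $Z$, $X$ and $S$ that satisfy $Z>0$, $Z+S>0$ and $\Theta>0$.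
   Context: Prime denotes transpose; $>0$ ($\ge0$) means positive (semi-)definite. Setting: state $x_k\in\mathbb R^n$, $k\ge0$; local control $u_k^L\in\mathbb R^{m_1}$, remote control $u_k^R\in\mathbb R^{m_2}$; $x_{k+1}=Ax_k+B^Lu_k^L+B^Ru_k^R$. Observations: $y_k^L=Cx_k+v_k\in\mathbb R^n$ (local), $y_k^R=\eta_k\hat x^L_{k|k}$ (remote), with $\{v_k\}$ i.i.d. Gaussian with mean $0$ and covariance $Q_v$, and $\{\eta_k\}$ i.i.d. Bernoulli with $\mathbb P(\eta_k=0)=p$, $\mathbb P(\eta_k=1)=1-p$; $x_0$ (Gaussian), $\{v_k\}$, $\{\eta_k\}$ are mutually independent. Information: $\mathcal F^L_k=\sigma(y^L_0,\dots,y^L_k,y^R_0,\dots,y^R_k)$, $\mathcal F^R_k=\sigma(y^R_0,\dots,y^R_k)$; $\hat x^L_{k|k}=\mathbb E[x_k\mid\mathcal F^L_k]$, $\hat x^R_{k|k}=\mathbb E[x_k\mid\mathcal F^R_k]$. With $\hat u_k^L=\mathbb E[u_k^L\mid\mathcal F_k^R]$, $\tilde u_k^L=u_k^L-\hat u_k^L$, $U_k=\begin{bmatrix}\hat u_k^L\\ u_k^R\end{bmatrix}$, $B=[B^L\ B^R]$, $R=\operatorname{diag}(R^L,R^R)$, the system takes the form in the claim. Definitions. A system is asymptotically mean-square stable if for any initial value $x_0$ one has $\lim_{k\to\infty}\mathbb E[x_k'x_k]=0$. The system is stabilizable in the mean-square sense if there exist an $\mathcal F^R_k$-measurable $U_k=-K_0\hat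 x^R_{k|k}-\bar K_0\mathbb E\hat x^R_{k|k}$ and an $\mathcal F^L_k$-measurable $\tilde u_k^L=-F_0(\hat x^L_{k|k}-\hat x^R_{k|k})$ with constant matrices $K_0,\bar K_0,F_0$ such that for any $x_0$ the closed-loop system is asymptotically mean-square stable. Notation: $Q\ge0$, $Q_\mu=Q+\mu Q$; $\Upsilon=B'ZB+R$, $K=\Upsilon^{-1}B'ZA$, $M=B'ZB+B'SB+R$, $N=B'ZA+B'SA$, $\Theta=(1-p)Z+pX$, $\Lambda=(B^L)'\Theta B^L+R^L$, $L=(B^L)'\Theta A$. *)

theory Defs
  imports "HOL-Probability.Probability"
begin

section \<open>Matrices\<close>

definition psd :: "real^'n^'n \<Rightarrow> bool" where
  "psd P \<longleftrightarrow> transpose P = P \<and> (\<forall>x. 0 \<le> x \<bullet> (P *v x))"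

definition posdef :: "real^'n^'n \<Rightarrow> bool" where
  "posdef P \<longleftrightarrow> transpose P = P \<and> (\<forall>x. x \<noteq> 0 \<longrightarrow> 0 < x \<bullet> (P *v x))"

text \<open>A positive semidefinite \<open>P\<close> has exactly one positive semidefinite square root.\<close>

definition is_psd_sqrt :: "real^'n^'n \<Rightarrow> real^'n^'n \<Rightarrow> bool" where
  "is_psd_sqrt T P \<longleftrightarrow> psd T \<and> T ** T = P"

definition row_block :: "real^'l^'n \<Rightarrow> real^'r^'n \<Rightarrow> real^('l + 'r)^'n" where
  "row_block P P' = (\<chi> i j. case j of Inl a \<Rightarrow> P $ i $ a | Inr b \<Rightarrow> P' $ i $ b)"

definition diag_block :: "real^'l^'l \<Rightarrow> real^'r^'r \<Rightarrow> real^('l + 'r)^('l + 'r)" where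
  "diag_block P P' = (\<chi> i j. case (i, j) of
      (Inl a, Inl b) \<Rightarrow> P $ a $ b
    | (Inr a, Inr b) \<Rightarrow> P' $ a $ b
    | _ \<Rightarrow> 0)"

text \<open>The initial state is determined by the output \<open>C *v x\<^sub>k\<close> of the free system
  \<open>x\<^sub>k\<^sub>+\<^sub>1 = A *v x\<^sub>k\<close>.\<close>

definition observable :: "real^'n^'n \<Rightarrow> real^'n^'m \<Rightarrow> bool" where
  "observable A C \<longleftrightarrow> inj (\<lambda>x. (\<lambda>k::nat. C *v (((*v) A ^^ k) x)))"

definition schur_stable :: "real^'n^'n \<Rightarrow> bool" where
  "schur_stable P \<longleftrightarrow>
     (\<forall>(z::complex) w. w \<noteq> 0 \<and> map_matrix complex_of_real P *v w = z *s w \<longrightarrow> cmod z < 1)"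

definition detectable :: "real^'n^'n \<Rightarrow> real^'n^'m \<Rightarrow> bool" where
  "detectable A C \<longleftrightarrow> (\<exists>H :: real^'m^'n. schur_stable (A - H ** C))"

section \<open>Random vectors\<close>

definition events_of :: "'w measure \<Rightarrow> ('w \<Rightarrow> 'a::topological_space) \<Rightarrow> 'w set set" where
  "events_of M X = sets (vimage_algebra (space M) X borel)"

definition generated_by :: "'w measure \<Rightarrow> ('w \<Rightarrow> 'a::topological_space) set \<Rightarrow> 'w measure" where
  "generated_by M \<X> = sigma (space M) (\<Union>X\<in>\<X>. events_of M X)"

text \<open>\<open>Y\<close> is a version of the conditional expectation of the random vector \<open>X\<close> given \<open>F\<close>.\<close>

definition is_cond_exp :: "'w measure \<Rightarrow> 'w measure \<Rightarrow> ('w \<Rightarrow> real^'n) \<Rightarrow> ('w \<Rightarrow> real^'n) \<Rightarrow> bool" where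
  "is_cond_exp M F X Y \<longleftrightarrow> Y \<in> borel_measurable F \<and>
     (AE w in M. \<forall>i. Y w $ i = real_cond_exp M F (\<lambda>w. X w $ i) w)"

definition normal_law :: "real \<Rightarrow> real \<Rightarrow> real measure" where
  "normal_law m s =
     (if s = 0 then return borel m else density lborel (normal_density m (sqrt s)))"

text \<open>Gaussian vectors are characterised by their one-dimensional projections.  The covariance may
  be singular; in particular deterministic vectors are included.\<close>

definition gaussian :: "'w measure \<Rightarrow> ('w \<Rightarrow> real^'n) \<Rightarrow> real^'n \<Rightarrow> real^'n^'n \<Rightarrow> bool" where
  "gaussian M X m \<Sigma> \<longleftrightarrow> psd \<Sigma> \<and> X \<in> borel_measurable M \<and>
     (\<forall>a. distr M borel (\<lambda>w. a \<bullet> X w) = normal_law (a \<bullet> m) (a \<bullet> (\<Sigma> *v a)))"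

definition bernoulli :: "'w measure \<Rightarrow> ('w \<Rightarrow> real) \<Rightarrow> real \<Rightarrow> bool" where
  "bernoulli M \<eta> p \<longleftrightarrow> \<eta> \<in> borel_measurable M \<and>
     measure M {w \<in> space M. \<eta> w = 0} = p \<and> measure M {w \<in> space M. \<eta> w = 1} = 1 - p"

datatype source = Init | Noise nat | Channel nat

text \<open>The random data: Gaussian initial state \<open>x0\<close>, i.i.d. observation noise \<open>v\<close>, i.i.d. packet
  arrivals \<open>\<eta>\<close>, all mutually independent.\<close>

definition random_data ::
  "'w measure \<Rightarrow> ('w \<Rightarrow> real^'n) \<Rightarrow> (nat \<Rightarrow> 'w \<Rightarrow> real^'n) \<Rightarrow> (nat \<Rightarrow> 'w \<Rightarrow> real) \<Rightarrow>
   real^'n^'n \<Rightarrow> real \<Rightarrow> bool" where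
  "random_data M x0 v \<eta> Qv p \<longleftrightarrow>
     prob_space M \<and>
     (\<exists>m \<Sigma>. gaussian M x0 m \<Sigma>) \<and>
     (\<forall>k. gaussian M (v k) 0 Qv) \<and>
     (\<forall>k. bernoulli M (\<eta> k) p) \<and>
     prob_space.indep_sets M
       (\<lambda>s. case s of
            Init \<Rightarrow> events_of M x0
          | Noise k \<Rightarrow> events_of M (v k)
          | Channel k \<Rightarrow> events_of M (\<eta> k)) UNIV"

section \<open>The system with local and remote controller\<close>

definition local_info ::
  "'w measure \<Rightarrow> (nat \<Rightarrow> 'w \<Rightarrow> real^'n) \<Rightarrow> (nat \<Rightarrow> 'w \<Rightarrow> real^'n) \<Rightarrow> nat \<Rightarrow> 'w measure" where
  "local_info M yL yR k = generated_by M (yL ` {..k} \<union> yR ` {..k})"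

definition remote_info :: "'w measure \<Rightarrow> (nat \<Rightarrow> 'w \<Rightarrow> real^'n) \<Rightarrow> nat \<Rightarrow> 'w measure" where
  "remote_info M yR k = generated_by M (yR ` {..k})"

text \<open>Here \<open>xL k\<close>, \<open>xR k\<close> are the filtered estimates of \<open>x k\<close> given the local and the remote
  information.  Since \<open>yR k\<close> is part of the local information at time \<open>k\<close> and is itself formed from
  \<open>xL k\<close>, the equation for \<open>xL k\<close> alone is circular: it would also be solved by an estimate
  that equals the true state whenever \<open>\<eta> k = 1\<close>.  The measurability of \<open>xL k\<close> with respect
  to \<open>yL 0, \<dots>, yL k, yR 0, \<dots>, yR (k - 1)\<close> says that the packet is formed before \<open>yR k\<close> is
  received.  As \<open>\<eta> k\<close> is independent of the state and of these observations, the two requirements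
  are consistent and determine \<open>xL k\<close> up to null sets.\<close>

definition system_run ::
  "real^'n^'n \<Rightarrow> real^'l^'n \<Rightarrow> real^'r^'n \<Rightarrow> real^'n^'n \<Rightarrow>
   'w measure \<Rightarrow> ('w \<Rightarrow> real^'n) \<Rightarrow> (nat \<Rightarrow> 'w \<Rightarrow> real^'n) \<Rightarrow> (nat \<Rightarrow> 'w \<Rightarrow> real) \<Rightarrow>
   (nat \<Rightarrow> 'w \<Rightarrow> real^('l + 'r)) \<Rightarrow> (nat \<Rightarrow> 'w \<Rightarrow> real^'l) \<Rightarrow>
   (nat \<Rightarrow> 'w \<Rightarrow> real^'n) \<Rightarrow> (nat \<Rightarrow> 'w \<Rightarrow> real^'n) \<Rightarrow> (nat \<Rightarrow> 'w \<Rightarrow> real^'n) \<Rightarrow>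
   (nat \<Rightarrow> 'w \<Rightarrow> real^'n) \<Rightarrow> (nat \<Rightarrow> 'w \<Rightarrow> real^'n) \<Rightarrow> bool" where
  "system_run A BL BR C M x0 v \<eta> U uL x yL yR xL xR \<longleftrightarrow>
     (\<forall>w\<in>space M.
        x 0 w = x0 w \<and>
        (\<forall>k. x (Suc k) w = A *v x k w + row_block BL BR *v U k w + BL *v uL k w) \<and>
        (\<forall>k. yL k w = C *v x k w + v k w) \<and>
        (\<forall>k. yR k w = \<eta> k w *\<^sub>R xL k w)) \<and>
     (\<forall>k. xL k \<in> borel_measurable (generated_by M (yL ` {..k} \<union> yR ` {..<k}))) \<and>
     (\<forall>k. is_cond_exp M (local_info M yL yR k) (x k) (xL k)) \<and>
     (\<forall>k. is_cond_exp M (remote_info M yR k) (x k) (xR k))"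

definition asymp_ms_stable :: "'w measure \<Rightarrow> (nat \<Rightarrow> 'w \<Rightarrow> real^'n) \<Rightarrow> bool" where
  "asymp_ms_stable M x \<longleftrightarrow>
     (\<forall>k. integrable M (\<lambda>w. x k w \<bullet> x k w)) \<and>
     (\<lambda>k. \<integral>w. x k w \<bullet> x k w \<partial>M) \<longlonglongrightarrow> 0"

text \<open>Stability for every initial value refers to an arbitrary Gaussian \<open>x0\<close>.  The sample space is
  not fixed: every joint law of \<open>(x0, v, \<eta>)\<close> is realised by the coordinate maps of the type below,
  so quantifying over all probability measures on it loses no initial law.\<close>

type_synonym 'n sample = "(real^'n) \<times> (nat \<Rightarrow> real^'n) \<times> (nat \<Rightarrow> real)"

definition ms_stabilizable ::
  "real^'n^'n \<Rightarrow> real^'l^'n \<Rightarrow> real^'r^'n \<Rightarrow> real^'n^'n \<Rightarrow> real^'n^'n \<Rightarrow> real \<Rightarrow> bool" where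
  "ms_stabilizable A BL BR C Qv p \<longleftrightarrow>
     (\<exists>(K0 :: real^'n^('l + 'r)) (K0' :: real^'n^('l + 'r)) (F0 :: real^'n^'l).
        \<forall>(M :: 'n sample measure) x0 v \<eta> U uL x yL yR xL xR.
          random_data M x0 v \<eta> Qv p \<and>
          system_run A BL BR C M x0 v \<eta> U uL x yL yR xL xR \<and>
          (\<forall>w\<in>space M. \<forall>k. U k w = - (K0 *v xR k w) - K0' *v (\<integral>w'. xR k w' \<partial>M)) \<and>
          (\<forall>w\<in>space M. \<forall>k. uL k w = - (F0 *v (xL k w - xR k w)))
          \<longrightarrow> asymp_ms_stable M x)"

section \<open>Coefficients of the Riccati equations\<close>

definition Upsilon :: "real^'m^'n \<Rightarrow> real^'m^'m \<Rightarrow> real^'n^'n \<Rightarrow> real^'m^'m" where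
  "Upsilon B R Z = transpose B ** Z ** B + R"

definition K_gain :: "real^'n^'n \<Rightarrow> real^'m^'n \<Rightarrow> real^'m^'m \<Rightarrow> real^'n^'n \<Rightarrow> real^'n^'m" where
  "K_gain A B R Z = matrix_inv (Upsilon B R Z) ** transpose B ** Z ** A"

definition M_mat :: "real^'m^'n \<Rightarrow> real^'m^'m \<Rightarrow> real^'n^'n \<Rightarrow> real^'n^'n \<Rightarrow> real^'m^'m" where
  "M_mat B R Z S = transpose B ** Z ** B + transpose B ** S ** B + R"

definition N_mat :: "real^'n^'n \<Rightarrow> real^'m^'n \<Rightarrow> real^'n^'n \<Rightarrow> real^'n^'n \<Rightarrow> real^'n^'m" where
  "N_mat A B Z S = transpose B ** Z ** A + transpose B ** S ** A"

definition Theta :: "real \<Rightarrow> real^'n^'n \<Rightarrow> real^'n^'n \<Rightarrow> real^'n^'n" where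
  "Theta p Z X = (1 - p) *\<^sub>R Z + p *\<^sub>R X"

definition Lambda :: "real^'l^'n \<Rightarrow> real^'l^'l \<Rightarrow> real^'n^'n \<Rightarrow> real^'l^'l" where
  "Lambda BL RL \<Theta> = transpose BL ** \<Theta> ** BL + RL"

definition L_mat :: "real^'n^'n \<Rightarrow> real^'l^'n \<Rightarrow> real^'n^'n \<Rightarrow> real^'n^'l" where
  "L_mat A BL \<Theta> = transpose BL ** \<Theta> ** A"

end

theory Submission
  imports Defs
begin

text \<open>Each of the three equations asks for a fixed point of a Riccati operator, where \<open>Z + S\<close> solves the
  equation of \<open>Z\<close> with weight \<open>Q\<close>.  Value iteration from \<open>0\<close> is monotone, so it converges as soon as
  it is bounded, and it is bounded if every initial state can be steered to states \<open>x N\<close> with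
  \<open>p ^ N * (norm (x N))\<^sup>2\<close> arbitrarily small (\<open>p = 1\<close> for \<open>Z\<close> and \<open>Z + S\<close>).
  The kernel of a solution is invariant under \<open>A\<close> and lies in that of \<open>Q\<close>, so it is trivial by observability.

  Such controls are read off from single outcomes of one stabilized closed loop started at \<open>g *\<^sub>R e\<close> with
  \<open>e\<close> a basis vector and \<open>g\<close> a standard normal variable.  For \<open>Z\<close> and \<open>Z + S\<close> an outcome with
  \<open>g \<ge> 1\<close> will do.  For \<open>X\<close> one takes the difference of two outcomes with \<open>g \<ge> 1\<close> and \<open>g \<le> -1\<close> in
  which all packets up to time \<open>N\<close> are lost: this has probability proportional to \<open>p ^ N\<close>, and
  the remote estimates and hence the controls \<open>U\<close> cancel.\<close>

section \<open>The Riccati operator\<close>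

text \<open>Stabilizability speaks about all runs of the closed loop and would be vacuous if there
  were none. Hence Gaussian data with covariance \<open>Qv\<close>, living on the prescribed sample
  type, and a run driven by them have to be constructed; the circular role of the packet
  \<open>yR k\<close> in the local estimate is the main obstacle there. In return no error
  covariance is ever computed: once an outcome is fixed, estimates and noise are plain sequences, so
  the controls read off from it are open-loop controls, and superposition turns those for basis
  vectors into linear ones.

  The factor \<open>p\<close> comes from \<open>Theta p Z X\<close>: with \<open>Z\<close> already
  known, \<open>(1 - p) *\<^sub>R Z\<close> acts as an additional running cost and only
  \<open>p *\<^sub>R X\<close> is passed on to the next step. Definiteness of
  \<open>Theta p Z X\<close> comes from \<open>Z\<close> if \<open>p < 1\<close>, and from the
  ordinary equation for \<open>X\<close> if \<open>p = 1\<close>.\<close>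

lemma inner_transpose:
  fixes P :: "real^'n^'m"
  shows "x \<bullet> (transpose P *v y) = (P *v x) \<bullet> y" "x \<bullet> (y v* P) = (P *v x) \<bullet> y"
  by (metis dot_lmul_matrix inner_commute transpose_matrix_vector)+

lemma inner_symmetric:
  "transpose P = P \<Longrightarrow> x \<bullet> (P *v y) = y \<bullet> ((P :: real^'n^'n) *v x)"
  by (metis inner_transpose(1) inner_commute)

lemma transpose_add: "transpose (P + P') = transpose P + transpose (P' :: real^'n^'m)"
  by (vector transpose_def)

lemma transpose_scaleR: "transpose (c *\<^sub>R P) = c *\<^sub>R transpose (P :: real^'n^'m)"
  by (vector transpose_def)

lemma transpose_diff: "transpose (P - P') = transpose P - transpose (P' :: real^'n^'m)"
  by (vector transpose_def)

lemma matrix_scaleR_vector: "(c *\<^sub>R P) *v x = c *\<^sub>R ((P :: real^'n^'m) *v x)"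
  by (rule scaleR_matrix_vector_assoc[symmetric])

lemma psdI: "transpose P = P \<Longrightarrow> (\<And>x. 0 \<le> x \<bullet> (P *v x)) \<Longrightarrow> psd P"
  by (simp add: psd_def)

lemma posdefI: "transpose P = P \<Longrightarrow> (\<And>x. x \<noteq> 0 \<Longrightarrow> 0 < x \<bullet> (P *v x)) \<Longrightarrow> posdef P"
  by (simp add: posdef_def)

lemma psd_zero: "psd 0"
  by (simp add: psd_def transpose_def vec_eq_iff)

lemma psd_add: "psd P \<Longrightarrow> psd P' \<Longrightarrow> psd (P + P')"
  by (simp add: psd_def transpose_add matrix_vector_mult_add_rdistrib inner_add_right)

lemma psd_scaleR: "0 \<le> c \<Longrightarrow> psd P \<Longrightarrow> psd (c *\<^sub>R P)"
  by (simp add: psd_def transpose_scaleR matrix_scaleR_vector)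

lemma posdef_imp_psd: "posdef P \<Longrightarrow> psd P"
  unfolding posdef_def psd_def by (metis inner_zero_left less_eq_real_def)

lemma psd_congruence: "psd P \<Longrightarrow> psd (transpose T ** P ** T)" for P :: "real^'n^'n"
  unfolding psd_def
  by (simp add: matrix_transpose_mul transpose_transpose matrix_mul_assoc
      matrix_vector_mul_assoc[symmetric] inner_transpose)

lemma posdef_invertible:
  fixes P :: "real^'n^'n"
  assumes "posdef P"
  shows "invertible P"
proof -
  have "x = 0" if "P *v x = 0" for x
    using assms that by (metis posdef_def inner_zero_right less_irrefl)
  then show ?thesis
    by (simp add: invertible_left_inverse matrix_left_invertible_ker)
qed

lemma matrix_inv_mult:
  fixes P :: "real^'n^'n"
  assumes "invertible P"
  shows "P *v (matrix_inv P *v x) = x" "matrix_inv P *v (P *v x) = x"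
proof -
  have "P ** matrix_inv P = mat 1 \<and> matrix_inv P ** P = mat 1"
    using assms unfolding invertible_def matrix_inv_def by (rule someI_ex)
  then show "P *v (matrix_inv P *v x) = x" "matrix_inv P *v (P *v x) = x"
    by (simp_all add: matrix_vector_mul_assoc)
qed

lemma transpose_matrix_inv:
  fixes P :: "real^'n^'n"
  assumes "transpose P = P" "invertible P"
  shows "transpose (matrix_inv P) = matrix_inv P"
proof -
  have "x \<bullet> (matrix_inv P *v y) = (matrix_inv P *v x) \<bullet> y" for x y
    by (metis assms inner_symmetric inner_commute matrix_inv_mult(1))
  then have "x \<bullet> (transpose (matrix_inv P) *v y) = x \<bullet> (matrix_inv P *v y)" for x y
    by (simp add: inner_transpose)
  then have "transpose (matrix_inv P) *v y = matrix_inv P *v y" for y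
    by (meson vector_eq_ldot)
  then show ?thesis
    by (simp add: matrix_eq)
qed

text \<open>The minimum of the form over the compact unit sphere is positive, and homogeneity
  spreads it to all vectors. The constant bounds inverses uniformly along value iteration.\<close>

lemma posdef_coercive:
  fixes P :: "real^'n^'n"
  assumes "posdef P"
  obtains r where "r > 0" "\<And>x. r * (x \<bullet> x) \<le> x \<bullet> (P *v x)"
proof -
  have cont: "continuous_on (sphere 0 1) (\<lambda>x. x \<bullet> (P *v x))"
    by (intro continuous_intros matrix_vector_mult_linear_continuous_on)
  have "axis (undefined :: 'n) (1::real) \<in> sphere 0 1"
    by simp
  then obtain y where y: "y \<in> sphere 0 1" "\<And>x. x \<in> sphere 0 1 \<Longrightarrow> y \<bullet> (P *v y) \<le> x \<bullet> (P *v x)"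
    using continuous_attains_inf[OF compact_sphere _ cont] by blast
  have "(y \<bullet> (P *v y)) * (x \<bullet> x) \<le> x \<bullet> (P *v x)" for x
  proof (cases "x = 0")
    case False
    define z where "z = (1 / norm x) *\<^sub>R x"
    have "y \<bullet> (P *v y) \<le> z \<bullet> (P *v z)"
      using False by (intro y) (simp add: z_def)
    also have "\<dots> = (x \<bullet> (P *v x)) / (x \<bullet> x)"
      by (simp add: z_def matrix_vector_mult_scaleR power2_norm_eq_inner[symmetric] power2_eq_square)
    finally show ?thesis
      using False by (simp add: pos_le_divide_eq)
  qed simp
  moreover have "0 < y \<bullet> (P *v y)"
    using assms y(1) norm_zero unfolding posdef_def by (metis mem_sphere_0 zero_neq_one)
  ultimately show ?thesis
    using that by blast
qed

text \<open>Shaped like the equation for \<open>X\<close>. For \<open>\<Theta> = Z\<close> the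
  matrix \<open>Lambda\<close> is \<open>Upsilon\<close>, and \<open>riccati_gain\<close> recovers
  the equation for \<open>Z\<close>, so one operator serves all three equations.\<close>

definition riccati ::
  "real^'n^'n \<Rightarrow> real^'m^'n \<Rightarrow> real^'n^'n \<Rightarrow> real^'m^'m \<Rightarrow> real^'n^'n \<Rightarrow> real^'n^'n" where
  "riccati A B G R \<Theta> = transpose A ** \<Theta> ** A + G
     - transpose (L_mat A B \<Theta>) ** matrix_inv (Lambda B R \<Theta>) ** L_mat A B \<Theta>"

definition stage_cost ::
  "real^'n^'n \<Rightarrow> real^'m^'n \<Rightarrow> real^'n^'n \<Rightarrow> real^'m^'m \<Rightarrow> real^'n^'n \<Rightarrow> real^'n \<Rightarrow> real^'m \<Rightarrow> real" where
  "stage_cost A B G R \<Theta> x u =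
     (A *v x + B *v u) \<bullet> (\<Theta> *v (A *v x + B *v u)) + x \<bullet> (G *v x) + u \<bullet> (R *v u)"

lemma posdef_Lambda: "psd \<Theta> \<Longrightarrow> posdef R \<Longrightarrow> posdef (Lambda B R \<Theta>)"
  unfolding Lambda_def
  by (drule psd_congruence[of _ B])
     (simp add: psd_def posdef_def transpose_add matrix_vector_mult_add_rdistrib inner_add_right
       add_nonneg_pos)

text \<open>Completing the square in \<open>u\<close>. The last term vanishes at
  \<open>u = - (F *v x)\<close>, so \<open>riccati\<close> is the minimal stage cost; monotonicity
  and upper bounds for value iteration follow from this.\<close>

lemma stage_cost_square:
  fixes A :: "real^'n^'n" and B :: "real^'m^'n"
  assumes "psd \<Theta>" "posdef R"
  defines "\<Lambda> \<equiv> Lambda B R \<Theta>"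
  defines "F \<equiv> matrix_inv \<Lambda> ** L_mat A B \<Theta>"
  shows "stage_cost A B G R \<Theta> x u =
    x \<bullet> (riccati A B G R \<Theta> *v x) + (u + F *v x) \<bullet> (\<Lambda> *v (u + F *v x))"
proof -
  have \<Lambda>: "posdef \<Lambda>"
    using assms posdef_Lambda by blast
  define l where "l = L_mat A B \<Theta> *v x"
  have sym: "transpose \<Theta> = \<Theta>" "transpose \<Lambda> = \<Lambda>"
    using assms \<Lambda> by (auto simp: psd_def posdef_def)
  have F: "\<Lambda> *v (F *v x) = l"
    by (simp add: F_def l_def matrix_vector_mul_assoc[symmetric] matrix_inv_mult(1)[OF posdef_invertible[OF \<Lambda>]])
  have u\<Lambda>u: "u \<bullet> (\<Lambda> *v u) = (B *v u) \<bullet> (\<Theta> *v (B *v u)) + u \<bullet> (R *v u)"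
    by (simp add: \<Lambda>_def Lambda_def matrix_vector_mult_add_rdistrib inner_add_right
        matrix_vector_mul_assoc[symmetric] inner_transpose)
  have ul: "u \<bullet> l = (B *v u) \<bullet> (\<Theta> *v (A *v x))"
    by (simp add: l_def L_mat_def matrix_vector_mul_assoc[symmetric] inner_transpose)
  have cross: "(F *v x) \<bullet> (\<Lambda> *v u) = u \<bullet> l"
    using F inner_symmetric[OF sym(2)] by metis
  have "x \<bullet> (riccati A B G R \<Theta> *v x) = (A *v x) \<bullet> (\<Theta> *v (A *v x)) + x \<bullet> (G *v x) - (F *v x) \<bullet> l"
    by (simp add: riccati_def F_def l_def \<Lambda>_def matrix_vector_mult_add_rdistrib
        matrix_vector_mult_diff_rdistrib inner_add_right inner_diff_right
        matrix_vector_mul_assoc[symmetric] inner_transpose inner_commute)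
  then show ?thesis
    unfolding stage_cost_def
    by (simp add: matrix_vector_right_distrib inner_add_left inner_add_right F u\<Lambda>u ul cross
        inner_symmetric[OF sym(1), of "A *v x" "B *v u"])
qed

lemma riccati_le_stage_cost:
  assumes "psd \<Theta>" "posdef R"
  shows "x \<bullet> (riccati A B G R \<Theta> *v x) \<le> stage_cost A B G R \<Theta> x u"
  using stage_cost_square[OF assms] posdef_imp_psd[OF posdef_Lambda[OF assms]]
  by (fastforce simp: psd_def)

lemma riccati_eq_stage_cost:
  assumes "psd \<Theta>" "posdef R"
  obtains u where "x \<bullet> (riccati A B G R \<Theta> *v x) = stage_cost A B G R \<Theta> x u"
  using stage_cost_square[OF assms, of A B G x "- (matrix_inv (Lambda B R \<Theta>) ** L_mat A B \<Theta> *v x)"]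
    that[of "- (matrix_inv (Lambda B R \<Theta>) ** L_mat A B \<Theta> *v x)"]
  by simp

lemma psd_riccati:
  fixes B :: "real^'m^'n"
  assumes "psd \<Theta>" "posdef R" "psd G"
  shows "psd (riccati A B G R \<Theta>)"
proof (rule psdI)
  have \<Lambda>: "posdef (Lambda B R \<Theta>)"
    using assms posdef_Lambda by blast
  show "transpose (riccati A B G R \<Theta>) = riccati A B G R \<Theta>"
    using assms \<Lambda> transpose_matrix_inv[OF _ posdef_invertible[OF \<Lambda>]]
    by (simp add: riccati_def psd_def posdef_def transpose_add transpose_diff matrix_transpose_mul
        transpose_transpose matrix_mul_assoc)
  fix x
  obtain u where "x \<bullet> (riccati A B G R \<Theta> *v x) = stage_cost A B G R \<Theta> x u"
    using assms riccati_eq_stage_cost by blast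
  then show "0 \<le> x \<bullet> (riccati A B G R \<Theta> *v x)"
    using assms posdef_imp_psd[OF assms(2)] by (simp add: stage_cost_def psd_def)
qed

text \<open>The control that is optimal for the larger weight \<open>\<Theta>'\<close> is still a
  candidate for the smaller one, where it costs no more.\<close>

lemma riccati_mono:
  fixes A :: "real^'n^'n"
  assumes "psd \<Theta>" "psd \<Theta>'" "posdef R" "\<And>y. y \<bullet> (\<Theta> *v y) \<le> y \<bullet> (\<Theta>' *v y)"
  shows "x \<bullet> (riccati A B G R \<Theta> *v x) \<le> x \<bullet> (riccati A B G R \<Theta>' *v x)"
proof -
  obtain u where "x \<bullet> (riccati A B G R \<Theta>' *v x) = stage_cost A B G R \<Theta>' x u"
    using assms riccati_eq_stage_cost by blast
  moreover have "stage_cost A B G R \<Theta> x u \<le> stage_cost A B G R \<Theta>' x u"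
    using assms(4) by (simp add: stage_cost_def)
  ultimately show ?thesis
    using riccati_le_stage_cost[OF assms(1,3)] by (metis order.trans)
qed

section \<open>Value iteration\<close>

lemma matrix_vector_nth_axis: "P $ i $ j = axis i 1 \<bullet> ((P :: real^'n^'m) *v axis j 1)"
  by (simp add: inner_axis' matrix_vector_mult_basis column_def)

lemma matrix_tendstoI:
  fixes X :: "'a \<Rightarrow> real^'n^'m"
  assumes "\<And>y. ((\<lambda>k. X k *v y) \<longlongrightarrow> P *v y) F"
  shows "(X \<longlongrightarrow> P) F"
proof (intro vec_tendstoI)
  fix i j
  have "((\<lambda>k. axis i 1 \<bullet> (X k *v axis j 1)) \<longlongrightarrow> axis i 1 \<bullet> (P *v axis j 1)) F"
    by (intro tendsto_intros assms)
  then show "((\<lambda>k. X k $ i $ j) \<longlongrightarrow> P $ i $ j) F"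
    by (simp add: matrix_vector_nth_axis)
qed

lemma tendsto_matrix_mult:
  fixes X :: "'a \<Rightarrow> real^'k^'m" and Y :: "'a \<Rightarrow> real^'n^'k"
  assumes "(X \<longlongrightarrow> P) F" "(Y \<longlongrightarrow> T) F"
  shows "((\<lambda>k. X k ** Y k) \<longlongrightarrow> P ** T) F"
  unfolding matrix_matrix_mult_def
  by (intro vec_tendstoI) (auto intro!: tendsto_intros assms)

lemma tendsto_matrix_vector:
  fixes X :: "'a \<Rightarrow> real^'k^'m"
  assumes "(X \<longlongrightarrow> P) F" "(y \<longlongrightarrow> z) F"
  shows "((\<lambda>k. X k *v y k) \<longlongrightarrow> P *v z) F"
  unfolding matrix_vector_mult_def
  by (intro vec_tendstoI) (auto intro!: tendsto_intros assms)

lemma tendsto_transpose: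
  fixes X :: "'a \<Rightarrow> real^'k^'m"
  assumes "(X \<longlongrightarrow> P) F"
  shows "((\<lambda>k. transpose (X k)) \<longlongrightarrow> transpose P) F"
  unfolding transpose_def by (intro vec_tendstoI) (auto intro!: tendsto_intros assms)

text \<open>The error \<open>e k\<close> solves \<open>X k *v e k = (P - X k) *v z\<close>. Testing
  this with \<open>e k\<close> and using the common lower bound \<open>r\<close> gives
  \<open>norm (e k) \<le> norm ((P - X k) *v z) / r\<close>, which tends to zero.\<close>

lemma tendsto_matrix_inv_coercive:
  fixes X :: "'a \<Rightarrow> real^'n^'n"
  assumes X: "(X \<longlongrightarrow> P) F" "invertible P" "\<And>k. invertible (X k)"
    and r: "r > 0" "\<And>k x. r * (x \<bullet> x) \<le> x \<bullet> (X k *v x)"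
  shows "((\<lambda>k. matrix_inv (X k)) \<longlongrightarrow> matrix_inv P) F"
proof (rule matrix_tendstoI)
  fix y
  define z where "z = matrix_inv P *v y"
  define e where "e k = matrix_inv (X k) *v y - z" for k
  have "X k *v e k = y - X k *v z" for k
    by (simp add: e_def matrix_vector_mult_diff_distrib matrix_inv_mult X)
  then have Xe: "X k *v e k = (P - X k) *v z" for k
    by (simp add: z_def matrix_inv_mult X matrix_vector_mult_diff_rdistrib)
  have "norm (e k) \<le> norm ((P - X k) *v z) / r" for k
  proof (cases "e k = 0")
    case False
    have "r * (norm (e k) * norm (e k)) \<le> norm (e k) * norm ((P - X k) *v z)"
      using r(2)[of "e k" k] norm_cauchy_schwarz[of "e k" "X k *v e k"]
      by (simp add: Xe power2_norm_eq_inner[symmetric] power2_eq_square)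
    then show ?thesis
      using False r(1) by (simp add: field_simps)
  qed (use r in simp)
  moreover have "((\<lambda>k. norm ((P - X k) *v z) / r) \<longlongrightarrow> norm ((P - P) *v z) / r) F"
    using r(1) by (intro tendsto_intros tendsto_matrix_vector X) auto
  ultimately have "(e \<longlongrightarrow> 0) F"
    by (intro Lim_null_comparison[of e]) auto
  then show "((\<lambda>k. matrix_inv (X k) *v y) \<longlongrightarrow> matrix_inv P *v y) F"
    unfolding e_def z_def by (simp add: Lim_null[symmetric])
qed

lemma psd_limit:
  fixes X :: "nat \<Rightarrow> real^'n^'n"
  assumes "X \<longlonglongrightarrow> P" "\<And>k. psd (X k)"
  shows "psd P"
proof (rule psdI)
  have "(\<lambda>k. transpose (X k)) \<longlonglongrightarrow> transpose P"
    by (intro tendsto_transpose assms)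
  moreover have "transpose (X k) = X k" for k
    using assms(2) by (simp add: psd_def)
  ultimately show "transpose P = P"
    using assms(1) LIMSEQ_unique by fastforce
  show "0 \<le> x \<bullet> (P *v x)" for x
    using assms(2) unfolding psd_def
    by (intro LIMSEQ_le_const[OF tendsto_inner[OF tendsto_const tendsto_matrix_vector[OF assms(1) tendsto_const]]]) auto
qed

text \<open>A coercivity constant of \<open>R\<close> serves every \<open>Lambda B R (T k)\<close>,
  since the semidefinite \<open>T k\<close> can only increase the form; hence inversion is
  continuous along the sequence.\<close>

lemma tendsto_riccati:
  fixes B :: "real^'m^'n"
  assumes T: "T \<longlonglongrightarrow> \<Theta>" "\<And>k. psd (T k)" and "posdef R"
  shows "(\<lambda>k. riccati A B G R (T k)) \<longlonglongrightarrow> riccati A B G R \<Theta>"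
proof -
  have \<Theta>: "psd \<Theta>"
    using T by (rule psd_limit)
  obtain r where r: "r > 0" "\<And>x. r * (x \<bullet> x) \<le> x \<bullet> (R *v x)"
    using posdef_coercive assms by blast
  have "r * (x \<bullet> x) \<le> x \<bullet> (Lambda B R (T k) *v x)" for k x
    using r(2)[of x] psd_congruence[OF T(2)[of k], of B]
    by (simp add: Lambda_def matrix_vector_mult_add_rdistrib inner_add_right psd_def add_increasing)
  then show ?thesis
    unfolding riccati_def
    by (intro tendsto_intros tendsto_matrix_mult tendsto_transpose T
        tendsto_matrix_inv_coercive[OF _ _ _ r(1)] posdef_invertible posdef_Lambda \<Theta> \<open>posdef R\<close>)
       (auto simp: L_mat_def Lambda_def intro!: tendsto_intros tendsto_matrix_mult T)
qed

text \<open>For each vector the values of the form are monotone and bounded, hence convergent.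
  Polarization, available by symmetry, carries this over to the bilinear form and so to the
  entries.\<close>

lemma psd_incseq_convergent:
  fixes X :: "nat \<Rightarrow> real^'n^'n"
  assumes X: "\<And>k. psd (X k)"
    and mono: "\<And>k x. x \<bullet> (X k *v x) \<le> x \<bullet> (X (Suc k) *v x)"
    and bound: "\<And>k x. x \<bullet> (X k *v x) \<le> c * (x \<bullet> x)"
  obtains P where "X \<longlonglongrightarrow> P"
proof -
  have "\<exists>l. (\<lambda>k. x \<bullet> (X k *v x)) \<longlonglongrightarrow> l" for x
    using incseq_convergent[of "\<lambda>k. x \<bullet> (X k *v x)" "c * (x \<bullet> x)"] mono bound
    by (metis incseq_SucI)
  then obtain q where q: "\<And>x. (\<lambda>k. x \<bullet> (X k *v x)) \<longlonglongrightarrow> q x"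
    by metis
  define b where "b x y = (q (x + y) - q x - q y) / 2" for x y
  have "(\<lambda>k. x \<bullet> (X k *v y)) \<longlonglongrightarrow> b x y" for x y
  proof -
    have eq: "x \<bullet> (X k *v y) = ((x + y) \<bullet> (X k *v (x + y)) - x \<bullet> (X k *v x) - y \<bullet> (X k *v y)) / 2" for k
      using X[of k] inner_symmetric[of "X k" x y]
      by (simp add: psd_def matrix_vector_right_distrib inner_add_left inner_add_right)
    show ?thesis
      unfolding eq b_def by (intro tendsto_intros q) simp
  qed
  then have "X \<longlonglongrightarrow> (\<chi> i j. b (axis i 1) (axis j 1))"
    by (intro vec_tendstoI) (simp add: matrix_vector_nth_axis)
  then show ?thesis
    using that by blast
qed

section \<open>Open-loop steering and bounded value iteration\<close>

primrec trajectory :: "real^'n^'n \<Rightarrow> real^'m^'n \<Rightarrow> (nat \<Rightarrow> real^'m) \<Rightarrow> real^'n \<Rightarrow> nat \<Rightarrow> real^'n" where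
  "trajectory A B u x 0 = x"
| "trajectory A B u x (Suc k) = A *v trajectory A B u x k + B *v u k"

lemma trajectory_sum:
  fixes B :: "real^'m^'n"
  assumes "finite I"
  shows "trajectory A B (\<lambda>k. \<Sum>i\<in>I. c i *\<^sub>R u i k) (\<Sum>i\<in>I. c i *\<^sub>R x i) k =
    (\<Sum>i\<in>I. c i *\<^sub>R trajectory A B (u i) (x i) k)"
  by (induction k)
     (simp_all add: matrix_vector_mult_scaleR linear_sum[OF matrix_vector_mul_linear] sum.distrib
       scaleR_add_right o_def)

text \<open>\<open>p\<close> plays the part of a squared discount factor: stabilizability of
  \<open>(sqrt p *\<^sub>R A, sqrt p *\<^sub>R B)\<close>, expressed through open-loop controls.\<close>

definition steerable :: "real^'n^'n \<Rightarrow> real^'m^'n \<Rightarrow> real \<Rightarrow> bool" where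
  "steerable A B p \<longleftrightarrow> (\<forall>i. \<forall>\<epsilon>>0. \<forall>\<^sub>F N in sequentially.
     \<exists>u. p ^ N * (norm (trajectory A B u (axis i 1) N))\<^sup>2 \<le> \<epsilon>)"

text \<open>Because steering is asked for all large \<open>N\<close>, the finitely many basis
  vectors can share one \<open>N\<close>. Superposition then makes the controls linear in the
  initial state: column \<open>i\<close> of \<open>U k\<close> is the control used for
  \<open>axis i 1\<close>.\<close>

lemma steerable_contraction:
  fixes A :: "real^'n^'n" and B :: "real^'m^'n"
  assumes "steerable A B p" "0 \<le> p"
  obtains N U where
    "\<And>x. p ^ N * (norm (trajectory A B (\<lambda>k. U k *v x) x N))\<^sup>2 \<le> (norm x)\<^sup>2 / 2"
proof -
  \<comment> \<open>The final state is a sum of \<open>CARD('n)\<close> terms, each at most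
    \<open>norm x * sqrt \<epsilon>\<close> after discounting; the square of the total is to be
    \<open>(norm x)\<^sup>2 / 2\<close>.\<close>
  define \<epsilon> where "\<epsilon> = 1 / (2 * (real CARD('n))\<^sup>2)"
  have "\<epsilon> > 0"
    by (simp add: \<epsilon>_def)
  then have "\<forall>\<^sub>F N in sequentially. \<forall>i\<in>UNIV. \<exists>u. p ^ N * (norm (trajectory A B u (axis i 1) N))\<^sup>2 \<le> \<epsilon>"
    using assms(1) by (intro eventually_ball_finite) (auto simp: steerable_def)
  then obtain N where "\<And>i. \<exists>u. p ^ N * (norm (trajectory A B u (axis i 1) N))\<^sup>2 \<le> \<epsilon>"
    unfolding eventually_sequentially by (metis UNIV_I order.refl)
  then obtain u where u: "\<And>i. p ^ N * (norm (trajectory A B (u i) (axis i 1) N))\<^sup>2 \<le> \<epsilon>"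
    by metis
  define U :: "nat \<Rightarrow> real^'n^'m" where "U k = (\<chi> a i. u i k $ a)" for k
  have U: "U k *v x = (\<Sum>i\<in>UNIV. x $ i *\<^sub>R u i k)" for k x
    by (simp add: U_def matrix_vector_mult_def vec_eq_iff mult.commute)
  have x: "x = (\<Sum>i\<in>UNIV. x $ i *\<^sub>R axis i 1)" for x :: "real^'n"
    by (simp add: vec_eq_iff axis_def if_distrib cong: if_cong)
  have "p ^ N * (norm (trajectory A B (\<lambda>k. U k *v x) x N))\<^sup>2 \<le> (norm x)\<^sup>2 / 2" for x
  proof -
    have e: "sqrt (p ^ N) * norm (trajectory A B (u i) (axis i 1) N) \<le> sqrt \<epsilon>" for i
      using real_sqrt_le_mono[OF u[of i]] by (simp add: real_sqrt_mult)
    have "trajectory A B (\<lambda>k. U k *v x) x N = (\<Sum>i\<in>UNIV. x $ i *\<^sub>R trajectory A B (u i) (axis i 1) N)"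
      using trajectory_sum[of UNIV A B "\<lambda>i. x $ i" u "\<lambda>i. axis i 1" N] x[of x] by (simp add: U)
    then have "sqrt (p ^ N) * norm (trajectory A B (\<lambda>k. U k *v x) x N)
        \<le> sqrt (p ^ N) * (\<Sum>i\<in>UNIV. \<bar>x $ i\<bar> * norm (trajectory A B (u i) (axis i 1) N))"
      using norm_sum[of "\<lambda>i. x $ i *\<^sub>R trajectory A B (u i) (axis i 1) N" UNIV] assms(2)
      by (intro mult_left_mono) simp_all
    also have "\<dots> = (\<Sum>i\<in>UNIV. \<bar>x $ i\<bar> * (sqrt (p ^ N) * norm (trajectory A B (u i) (axis i 1) N)))"
      by (simp add: sum_distrib_left mult_ac)
    also have "\<dots> \<le> (\<Sum>i\<in>(UNIV::'n set). norm x * sqrt \<epsilon>)"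
      using assms(2) by (intro sum_mono mult_mono e component_le_norm_cart) auto
    finally have "(sqrt (p ^ N) * norm (trajectory A B (\<lambda>k. U k *v x) x N))\<^sup>2
        \<le> (real CARD('n) * (norm x * sqrt \<epsilon>))\<^sup>2"
      using assms(2) by (intro power_mono) simp_all
    then show ?thesis
      using \<open>\<epsilon> > 0\<close> assms(2) by (simp add: power_mult_distrib) (simp add: \<epsilon>_def)
  qed
  then show ?thesis
    using that by blast
qed

lemma quadratic_form_bounded:
  fixes P :: "real^'n^'n"
  obtains c where "c \<ge> 0" "\<And>x. x \<bullet> (P *v x) \<le> c * (norm x)\<^sup>2"
proof -
  obtain c where c: "c > 0" "\<And>x. norm (P *v x) \<le> norm x * c"
    using bounded_linear.pos_bounded[OF matrix_vector_mul_bounded_linear[of P]] by blast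
  have "x \<bullet> (P *v x) \<le> c * (norm x)\<^sup>2" for x
    using order.trans[OF norm_cauchy_schwarz mult_left_mono[OF c(2)]]
    by (fastforce simp: power2_eq_square mult_ac)
  then show ?thesis
    using that[of c] c by simp
qed

text \<open>Linearity turns every cost incurred on the way into a quadratic form of the initial
  state, so a multiple of \<open>(norm x)\<^sup>2\<close> bounds it.\<close>

lemma trajectory_linear:
  obtains P where "\<And>x. trajectory A B (\<lambda>k. U k *v x) x N = P *v x"
proof (induction N arbitrary: thesis)
  case 0
  then show ?case
    using matrix_vector_mul_lid by (metis trajectory.simps(1))
next
  case (Suc N)
  obtain P where "\<And>x. trajectory A B (\<lambda>k. U k *v x) x N = P *v x"
    using Suc.IH by blast
  then have "trajectory A B (\<lambda>k. U k *v x) x (Suc N) = (A ** P + B ** U N) *v x" for x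
    by (simp add: matrix_vector_mult_add_rdistrib matrix_vector_mul_assoc)
  then show ?case
    by (rule Suc.prems)
qed

text \<open>Following the contracting controls for \<open>N\<close> steps costs at most
  \<open>c * (norm x)\<^sup>2\<close>, and what remains is the same problem with the discounted
  squared norm at most halved. The geometric series sums to \<open>2 * c\<close>, so value iteration
  converges, and continuity of the operator makes the limit a fixed point.\<close>

lemma riccati_solvable:
  fixes A G Z :: "real^'n^'n" and B :: "real^'m^'n" and R :: "real^'m^'m"
  assumes st: "steerable A B p" and p: "0 \<le> p" "p \<le> 1"
    and "psd G" "posdef R" "psd Z"
  obtains X where "psd X" "X = riccati A B G R (Theta p Z X)"
proof -
  define X where "X k = ((\<lambda>Y. riccati A B G R (Theta p Z Y)) ^^ k) 0" for k
  have X_Suc: "X (Suc k) = riccati A B G R (Theta p Z (X k))" and X_0: "X 0 = 0" for k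
    by (simp_all add: X_def)
  have psd_Theta: "psd (Theta p Z Y)" if "psd Y" for Y
    using that assms unfolding Theta_def by (intro psd_add psd_scaleR) auto
  have X: "psd (X k)" for k
    by (induction k) (auto simp: X_0 X_Suc psd_zero intro!: psd_riccati psd_Theta assms)
  have Theta_form: "x \<bullet> (Theta p Z Y *v x) = (1 - p) * (x \<bullet> (Z *v x)) + p * (x \<bullet> (Y *v x))" for x Y
    by (simp add: Theta_def matrix_vector_mult_add_rdistrib inner_add_right matrix_scaleR_vector)
  have mono: "x \<bullet> (X k *v x) \<le> x \<bullet> (X (Suc k) *v x)" for k x
  proof (induction k arbitrary: x)
    case 0
    then show ?case
      using X[of 1] by (simp add: X_0 psd_def)
  next
    case (Suc k)
    then show ?case
      unfolding X_Suc using p X X[of "Suc k", unfolded X_Suc]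
      by (intro riccati_mono psd_Theta \<open>posdef R\<close>) (auto simp: Theta_form mult_left_mono)
  qed
  obtain N U where contr: "\<And>x. p ^ N * (norm (trajectory A B (\<lambda>k. U k *v x) x N))\<^sup>2 \<le> (norm x)\<^sup>2 / 2"
    using steerable_contraction st p by blast
  let ?x = "\<lambda>x. trajectory A B (\<lambda>k. U k *v x) x"
  \<comment> \<open>Unrolling \<open>n\<close> steps of value iteration: suboptimal controls give an
    upper bound, and each step multiplies the continuing part by \<open>p\<close>.\<close>
  have "\<exists>c\<ge>0. \<forall>k x. x \<bullet> (X (k + n) *v x) \<le> c * (norm x)\<^sup>2 + p ^ n * (?x x n \<bullet> (X k *v ?x x n))" for n
  proof (induction n)
    case 0
    show ?case
      by (intro exI[of _ 0]) simp
  next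
    case (Suc n)
    then obtain c where c: "c \<ge> 0"
      "\<And>k x. x \<bullet> (X (k + n) *v x) \<le> c * (norm x)\<^sup>2 + p ^ n * (?x x n \<bullet> (X k *v ?x x n))"
      by blast
    obtain P where P: "\<And>x. ?x x n = P *v x"
      using trajectory_linear[of A B U n] by blast
    obtain P' where P': "\<And>x. ?x x (Suc n) = P' *v x"
      using trajectory_linear[of A B U "Suc n"] by blast
    have step: "A *v (P *v x) + B *v (U n *v x) = P' *v x" for x
      using P'[of x] unfolding trajectory.simps P .
    \<comment> \<open>The cost of step \<open>n\<close>: state and control weights, and the share
      \<open>(1 - p) *\<^sub>R Z\<close> of the terminal weight at the next state.\<close>
    define W where "W = transpose P ** G ** P + transpose (U n) ** R ** U n
      + transpose P' ** ((1 - p) *\<^sub>R Z) ** P'"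
    obtain c' where c': "c' \<ge> 0" "\<And>x. x \<bullet> (W *v x) \<le> c' * (norm x)\<^sup>2"
      using quadratic_form_bounded[of W] by blast
    have "x \<bullet> (X (k + Suc n) *v x)
        \<le> (c + p ^ n * c') * (norm x)\<^sup>2 + p ^ Suc n * (?x x (Suc n) \<bullet> (X k *v ?x x (Suc n)))" for k x
    proof -
      have "?x x n \<bullet> (X (Suc k) *v ?x x n)
          \<le> stage_cost A B G R (Theta p Z (X k)) (?x x n) (U n *v x)"
        unfolding X_Suc by (intro riccati_le_stage_cost psd_Theta X \<open>posdef R\<close>)
      also have "\<dots> = x \<bullet> (W *v x) + p * ((P' *v x) \<bullet> (X k *v (P' *v x)))"
        unfolding stage_cost_def Theta_form P step W_def
        by (simp add: matrix_vector_mult_add_rdistrib inner_add_right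
            matrix_vector_mul_assoc[symmetric] inner_transpose matrix_scaleR_vector)
      also have "\<dots> \<le> c' * (norm x)\<^sup>2 + p * (?x x (Suc n) \<bullet> (X k *v ?x x (Suc n)))"
        using c'(2)[of x] unfolding P' by linarith
      finally have "p ^ n * (?x x n \<bullet> (X (Suc k) *v ?x x n))
          \<le> p ^ n * (c' * (norm x)\<^sup>2 + p * (?x x (Suc n) \<bullet> (X k *v ?x x (Suc n))))"
        using p by (intro mult_left_mono) auto
      then show ?thesis
        using c(2)[of x "Suc k"] by (simp add: algebra_simps)
    qed
    then show ?case
      using c c' p by (intro exI[of _ "c + p ^ n * c'"]) simp
  qed
  then obtain c where c: "c \<ge> 0"
    "\<And>k x. x \<bullet> (X (k + N) *v x) \<le> c * (norm x)\<^sup>2 + p ^ N * (?x x N \<bullet> (X k *v ?x x N))"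
    by blast
  have "x \<bullet> (X k *v x) \<le> 2 * c * (norm x)\<^sup>2" for k x
  proof (cases "N = 0")
    \<comment> \<open>Multiples of \<open>N\<close> could not reach \<open>k\<close> here, but the
      contraction reads \<open>(norm x)\<^sup>2 \<le> (norm x)\<^sup>2 / 2\<close>.\<close>
    case True
    then have "x = 0"
      using contr[of x] by simp
    then show ?thesis
      by simp
  next
    case False
    \<comment> \<open>The bound reproduces itself because
      \<open>c + 2 * c / 2 = 2 * c\<close>.\<close>
    have "x \<bullet> (X (m * N) *v x) \<le> 2 * c * (norm x)\<^sup>2" for m
    proof (induction m arbitrary: x)
      case 0
      then show ?case
        using c(1) by (simp add: X_0)
    next
      case (Suc m)
      have "x \<bullet> (X (m * N + N) *v x) \<le> c * (norm x)\<^sup>2 + p ^ N * (2 * c * (norm (?x x N))\<^sup>2)"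
        using c(2)[of x "m * N"] mult_left_mono[OF Suc.IH[of "?x x N"], of "p ^ N"] p by simp
      also have "\<dots> \<le> c * (norm x)\<^sup>2 + 2 * c * ((norm x)\<^sup>2 / 2)"
        using mult_left_mono[OF contr[of x], of "2 * c"] c(1) by (simp add: mult_ac)
      finally show ?case
        by (simp add: add.commute)
    qed
    \<comment> \<open>Since \<open>k \<le> k * N\<close>, monotonicity passes the bound from
      multiples of \<open>N\<close> to every index.\<close>
    moreover have "x \<bullet> (X k *v x) \<le> x \<bullet> (X (k * N) *v x)"
      by (rule lift_Suc_mono_le[of "\<lambda>k. x \<bullet> (X k *v x)"]) (use mono False in auto)
    ultimately show ?thesis
      using order.trans by blast
  qed
  then have "x \<bullet> (X k *v x) \<le> 2 * c * (x \<bullet> x)" for k x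
    by (simp add: power2_norm_eq_inner)
  then obtain P where P: "X \<longlonglongrightarrow> P"
    using psd_incseq_convergent[of X, OF X mono] by blast
  have "(\<lambda>k. X (Suc k)) \<longlonglongrightarrow> riccati A B G R (Theta p Z P)"
    unfolding X_Suc
    by (intro tendsto_riccati psd_Theta X \<open>posdef R\<close>) (auto simp: Theta_def intro!: tendsto_intros P)
  then have "P = riccati A B G R (Theta p Z P)"
    using LIMSEQ_Suc[OF P] LIMSEQ_unique by blast
  then show ?thesis
    using that psd_limit[of X, OF P X] by blast
qed

lemma riccati_posdef:
  fixes A :: "real^'n^'n"
  assumes X: "psd X" "X = riccati A B G R X" and "psd G" "posdef R"
    and obs: "\<And>x. x \<noteq> 0 \<Longrightarrow> \<exists>k. ((*v) A ^^ k) x \<bullet> (G *v ((*v) A ^^ k) x) \<noteq> 0"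
  shows "posdef X"
proof (rule posdefI)
  show "transpose X = X"
    using X by (simp add: psd_def)
  fix x :: "real^'n"
  assume "x \<noteq> 0"
  \<comment> \<open>All three nonnegative terms of the optimal stage cost vanish. As
    \<open>R\<close> is definite this forces \<open>u = 0\<close>, so the optimal next state is
    \<open>A *v x\<close>.\<close>
  have zero: "x \<bullet> (G *v x) = 0 \<and> (A *v x) \<bullet> (X *v (A *v x)) = 0" if "x \<bullet> (X *v x) = 0" for x
  proof -
    obtain u where "x \<bullet> (X *v x) = stage_cost A B G R X x u"
      using riccati_eq_stage_cost[OF X(1) \<open>posdef R\<close>, of x A B G] X(2) by metis
    then have eq: "(A *v x + B *v u) \<bullet> (X *v (A *v x + B *v u)) + x \<bullet> (G *v x) + u \<bullet> (R *v u) = 0"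
      using that by (simp add: stage_cost_def)
    moreover have "0 \<le> (A *v x + B *v u) \<bullet> (X *v (A *v x + B *v u))" "0 \<le> x \<bullet> (G *v x)" "0 \<le> u \<bullet> (R *v u)"
      using X \<open>psd G\<close> posdef_imp_psd[OF \<open>posdef R\<close>] by (auto simp: psd_def)
    ultimately have "u \<bullet> (R *v u) = 0"
      by linarith
    then have "u = 0"
      using \<open>posdef R\<close> by (metis posdef_def less_irrefl)
    then show ?thesis
      using eq X(1) \<open>psd G\<close> by (simp add: psd_def add_nonneg_eq_0_iff)
  qed
  have "x \<bullet> (X *v x) \<noteq> 0"
  proof
    assume 0: "x \<bullet> (X *v x) = 0"
    have "((*v) A ^^ k) x \<bullet> (X *v ((*v) A ^^ k) x) = 0" for k
      by (induction k) (use 0 zero in auto)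
    then show False
      using obs \<open>x \<noteq> 0\<close> zero by blast
  qed
  then show "0 < x \<bullet> (X *v x)"
    using X by (simp add: psd_def less_le)
qed

section \<open>Generated sigma-algebras and conditional expectations\<close>

lemma events_of_eq: "events_of M X = {X -` S \<inter> space M |S. S \<in> sets borel}"
  unfolding events_of_def by (rule sets_vimage_algebra2) simp

lemma Int_stable_events_of: "Int_stable (events_of M X)"
  unfolding events_of_def by (rule sets.Int_stable)

lemma events_of_subset: "X \<in> borel_measurable N \<Longrightarrow> space N = space M \<Longrightarrow> events_of M X \<subseteq> sets N"
  using measurable_sets[of X N borel] by (auto simp: events_of_eq)

lemma measurable_if_events_of:
  "events_of M X \<subseteq> sets N \<Longrightarrow> space N = space M \<Longrightarrow> X \<in> borel_measurable N"
  by (rule measurableI) (auto simp: events_of_eq)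

lemma space_generated_by [simp]: "space (generated_by M \<X>) = space M"
  by (simp add: generated_by_def space_measure_of_conv)

lemma sets_generated_by: "sets (generated_by M \<X>) = sigma_sets (space M) (\<Union>X\<in>\<X>. events_of M X)"
  unfolding generated_by_def by (rule sets_measure_of) (auto simp: events_of_eq)

lemma measurable_generated_by: "X \<in> \<X> \<Longrightarrow> X \<in> borel_measurable (generated_by M \<X>)"
  by (rule measurable_if_events_of[of M]) (auto simp: sets_generated_by)

lemma generated_by_subset:
  assumes "\<And>X. X \<in> \<X> \<Longrightarrow> X \<in> borel_measurable N" "space N = space M"
  shows "sets (generated_by M \<X>) \<subseteq> sets N"
  using assms events_of_subset[of _ N M] unfolding sets_generated_by assms(2)[symmetric]
  by (intro sets.sigma_sets_subset) (auto simp: assms(2))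

lemma generated_by_mono: "\<X> \<subseteq> \<Y> \<Longrightarrow> sets (generated_by M \<X>) \<subseteq> sets (generated_by M \<Y>)"
  by (intro generated_by_subset measurable_generated_by) auto

lemma borel_measurable_vec_nth: "(\<lambda>x. x $ i) \<in> borel_measurable (borel :: (real^'n) measure)"
  by (intro borel_measurable_continuous_onI continuous_intros)

lemma borel_measurable_vec_lambda:
  assumes "\<And>i. (\<lambda>w. f w $ i) \<in> borel_measurable N"
  shows "(f :: 'w \<Rightarrow> real^'n) \<in> borel_measurable N"
  unfolding borel_measurable_euclidean_space[of f]
  using assms by (auto simp: Basis_vec_def inner_axis)

lemma borel_measurable_matrix:
  "X \<in> borel_measurable N \<Longrightarrow> (\<lambda>w. (P :: real^'n^'m) *v X w) \<in> borel_measurable N"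
  by (rule measurable_compose[of X N borel])
     (auto intro!: borel_measurable_continuous_onI matrix_vector_mult_linear_continuous_on)

lemma integrable_vec_nth:
  "integrable M X \<Longrightarrow> integrable M (\<lambda>w. (X w :: real^'n) $ i)"
  by (rule integrable_bounded_linear[OF bounded_linear_vec_nth])

lemma integrable_vec_lambda:
  fixes X :: "'w \<Rightarrow> real^'n"
  assumes "\<And>i. integrable M (\<lambda>w. X w $ i)"
  shows "integrable M X"
proof -
  have "integrable M (\<lambda>w. \<Sum>i\<in>UNIV. (X w $ i) *\<^sub>R axis i (1::real))"
    by (intro Bochner_Integration.integrable_sum integrable_scaleR_left assms)
  moreover have "(\<lambda>w. \<Sum>i\<in>UNIV. (X w $ i) *\<^sub>R axis i 1) = X"
    by (auto simp: vec_eq_iff axis_def if_distrib cong: if_cong)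
  ultimately show ?thesis
    by simp
qed

lemma integrable_matrix:
  "integrable M X \<Longrightarrow> integrable M (\<lambda>w. (P :: real^'n^'m) *v X w)"
  by (rule integrable_bounded_linear[OF matrix_vector_mul_bounded_linear])

lemma (in prob_space) sigma_finite_subalgebra:
  "space F = space M \<Longrightarrow> sets F \<subseteq> sets M \<Longrightarrow> sigma_finite_subalgebra M F"
proof -
  assume "space F = space M" "sets F \<subseteq> sets M"
  then interpret finite_measure_subalgebra M F
    by unfold_locales (simp add: subalgebra_def)
  show ?thesis
    by (rule sigma_finite_subalgebra_axioms)
qed

definition vec_cond_exp :: "'w measure \<Rightarrow> 'w measure \<Rightarrow> ('w \<Rightarrow> real^'n) \<Rightarrow> 'w \<Rightarrow> real^'n" where
  "vec_cond_exp M F X = (\<lambda>w. \<chi> i. real_cond_exp M F (\<lambda>w. X w $ i) w)"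

lemma measurable_vec_cond_exp: "vec_cond_exp M F X \<in> borel_measurable F"
  by (rule borel_measurable_vec_lambda) (simp add: vec_cond_exp_def)

lemma is_cond_exp_vec_cond_exp: "is_cond_exp M F X (vec_cond_exp M F X)"
  by (simp add: is_cond_exp_def measurable_vec_cond_exp) (simp add: vec_cond_exp_def)

lemma (in prob_space) integrable_vec_cond_exp:
  assumes "integrable M X" "space F = space M" "sets F \<subseteq> sets M"
  shows "integrable M (vec_cond_exp M F X)"
  unfolding vec_cond_exp_def
  using sigma_finite_subalgebra.real_cond_exp_int(1)[OF sigma_finite_subalgebra[OF assms(2,3)]
      integrable_vec_nth[OF assms(1)]]
  by (intro integrable_vec_lambda) simp

text \<open>Independence is assumed between \<open>E\<close> and the sets of \<open>H\<close>. It
  extends to the sigma-algebras generated by \<open>indicator E\<close> and \<open>f\<close>, and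
  expectations of independent variables multiply.\<close>

lemma (in prob_space) integral_indep_event:
  fixes f :: "'a \<Rightarrow> real"
  assumes f: "integrable M f" "f \<in> borel_measurable H" and H: "space H = space M" "sets H \<subseteq> events"
    and E: "E \<in> events" "\<And>A. A \<in> sets H \<Longrightarrow> prob (A \<inter> E) = prob A * prob E"
  shows "(\<integral>w. indicator E w * f w \<partial>M) = prob E * (\<integral>w. f w \<partial>M)"
proof -
  have "sigma_sets (space M) {indicator E -` S \<inter> space M |S. S \<in> sets (borel :: real measure)}
      \<subseteq> sigma_sets (space M) {E}"
  proof (rule sigma_sets_mono, safe)
    fix S :: "real set"
    have E_sub: "E \<subseteq> space M"
      using E(1) sets.sets_into_space by blast
    have ss: "E \<in> sigma_sets (space M) {E}" "space M - E \<in> sigma_sets (space M) {E}"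
      "{} \<in> sigma_sets (space M) {E}" "space M \<in> sigma_sets (space M) {E}"
      by (auto intro: sigma_sets.intros sigma_sets_top)
    have "indicator E -` S \<inter> space M = (if (1::real) \<in> S then if 0 \<in> S then space M else E
        else if 0 \<in> S then space M - E else {})"
      using E_sub by (auto simp: indicator_def of_bool_def split: if_splits)
    then show "indicator E -` S \<inter> space M \<in> sigma_sets (space M) {E}"
      using ss by presburger
  qed
  moreover have "sigma_sets (space M) {f -` S \<inter> space M |S. S \<in> sets borel} \<subseteq> sets H"
    using f(2) H(1) measurable_sets[of f H] unfolding H(1)[symmetric]
    by (intro sets.sigma_sets_subset) (auto simp: H(1))
  moreover have "indep_set (sigma_sets (space M) {E}) (sigma_sets (space M) (sets H))"
  proof (rule indep_set_sigma_sets)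
    show "indep_set {E} (sets H)"
      using E H by (intro indep_setI) (auto simp: Int_commute mult.commute)
    show "Int_stable {E}" "Int_stable (sets H)"
      by (auto simp: Int_stable_def)
  qed
  moreover have "sigma_sets (space M) (sets H) = sets H"
    using sets.sigma_sets_eq[of H] H(1) by simp
  ultimately have "indep_set (sigma_sets (space M) {indicator E -` S \<inter> space M |S. S \<in> sets (borel :: real measure)})
      (sigma_sets (space M) {f -` S \<inter> space M |S. S \<in> sets borel})"
    unfolding indep_sets2_eq by (metis (no_types, lifting) subset_eq)
  then have "indep_var borel (indicator E) borel f"
    using f E unfolding indep_var_eq by auto
  moreover have "integrable M (indicator E :: 'a \<Rightarrow> real)"
    using E by (intro integrable_real_indicator) (auto simp: less_top[symmetric])
  ultimately show ?thesis
    using f E by (subst indep_var_lebesgue_integral) auto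
qed

text \<open>Learning whether an independent event \<open>E\<close> occurs does not change the conditional
  expectation, even if only a part \<open>L\<close> of the information in \<open>G\<close> and \<open>E\<close> is passed on.\<close>

lemma (in prob_space) real_cond_exp_indep_event:
  assumes f: "integrable M f" "f \<in> borel_measurable H" and H: "space H = space M" "sets H \<subseteq> events"
    and G: "space G = space M" "sets G \<subseteq> sets H"
    and L: "space L = space M" "sets G \<subseteq> sets L" "sets L \<subseteq> events"
    and E: "E \<in> events" "\<And>A. A \<in> sets H \<Longrightarrow> prob (A \<inter> E) = prob A * prob E"
    and split: "\<And>A. A \<in> sets L \<Longrightarrow> \<exists>A0\<in>sets G. \<exists>A1\<in>sets G. A = A1 \<inter> E \<union> (A0 - E)"
  shows "AE w in M. real_cond_exp M L f w = real_cond_exp M G f w"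
proof -
  interpret L: sigma_finite_subalgebra M L
    using L by (intro sigma_finite_subalgebra)
  interpret G: sigma_finite_subalgebra M G
    using G H by (intro sigma_finite_subalgebra) auto
  define g where "g = real_cond_exp M G f"
  have g: "integrable M g" "g \<in> borel_measurable G"
    unfolding g_def using f by auto
  have meas_mono: "h \<in> borel_measurable F'" if "h \<in> borel_measurable F" "space F = space M"
    "space F' = space M" "sets F \<subseteq> sets F'" for h :: "'a \<Rightarrow> real" and F F'
    using that measurable_mono[of borel borel F F'] by auto
  have gH: "g \<in> borel_measurable H"
    using meas_mono[OF g(2)] G H by simp
  show ?thesis
    unfolding g_def[symmetric]
  proof (rule L.real_cond_exp_charact)
    show "g \<in> borel_measurable L"
      using meas_mono[OF g(2)] G L by simp
    fix A assume "A \<in> sets L"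
    then obtain A0 A1 where A: "A0 \<in> sets G" "A1 \<in> sets G" "A = A1 \<inter> E \<union> (A0 - E)"
      using split by blast
    \<comment> \<open>Integration over a set of the split form gives \<open>A1\<close> the weight
      \<open>prob E\<close> and \<open>A0\<close> the complementary weight. This holds for
      \<open>f\<close> and \<open>g\<close> alike, and their integrals over \<open>A0\<close> and
      \<open>A1\<close>, which lie in \<open>G\<close>, agree.\<close>
    have key: "(\<integral>w\<in>A. h w \<partial>M) = prob E * (\<integral>w\<in>A1. h w \<partial>M) + (1 - prob E) * (\<integral>w\<in>A0. h w \<partial>M)"
      if h: "integrable M h" "h \<in> borel_measurable H" for h :: "'a \<Rightarrow> real"
    proof -
      have ev: "A0 \<in> events" "A1 \<in> events"
        using A G H by auto
      have int: "integrable M (\<lambda>w. indicator S w * h w)" if "S \<in> events" for S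
        using integrable_mult_indicator[OF that h(1)] by simp
      have int2: "integrable M (\<lambda>w. indicator E w * (indicator S w * h w))" if "S \<in> events" for S
        using integrable_mult_indicator[OF E(1) int[OF that]] by simp
      have ind: "(\<integral>w. indicator E w * (indicator S w * h w) \<partial>M) = prob E * (\<integral>w. indicator S w * h w \<partial>M)"
        if "S \<in> sets G" for S
        using that G H h int[of S] E by (intro integral_indep_event[of _ H]) auto
      have "(\<integral>w\<in>A. h w \<partial>M) = (\<integral>w. indicator E w * (indicator A1 w * h w) + (indicator A0 w * h w
          - indicator E w * (indicator A0 w * h w)) \<partial>M)"
        unfolding set_lebesgue_integral_def A(3)
        by (intro Bochner_Integration.integral_cong) (auto simp: indicator_def)
      also have "\<dots> = prob E * (\<integral>w. indicator A1 w * h w \<partial>M) + ((\<integral>w. indicator A0 w * h w \<partial>M)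
          - prob E * (\<integral>w. indicator A0 w * h w \<partial>M))"
        using int int2 ev A by (simp add: ind)
      finally show ?thesis
        by (simp add: set_lebesgue_integral_def algebra_simps)
    qed
    show "(\<integral>w\<in>A. f w \<partial>M) = (\<integral>w\<in>A. g w \<partial>M)"
      unfolding key[OF f] key[OF g(1) gH]
      using A G.real_cond_exp_intA[OF f(1)] by (simp add: g_def)
  qed (use f g in auto)
qed

section \<open>Closed-loop runs\<close>

text \<open>On \<open>E\<close> the packet is \<open>Z\<close>, which is already measurable, and off
  \<open>E\<close> it is zero. Hence an event involving the packet is described by one known event
  on \<open>E\<close> and another off \<open>E\<close>, and sets of this kind form a
  sigma-algebra.\<close>

lemma generated_by_insert_packet:
  fixes Y Z :: "'w \<Rightarrow> real^'n" and b :: "'w \<Rightarrow> real"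
  assumes Z: "Z \<in> borel_measurable (generated_by M \<X>)"
    and Y: "\<And>w. w \<in> space M \<Longrightarrow> b w \<in> {0, 1} \<and> Y w = b w *\<^sub>R Z w"
    and A: "A \<in> sets (generated_by M (insert Y \<X>))"
  defines "E \<equiv> {w \<in> space M. b w = 1}"
  shows "\<exists>A0\<in>sets (generated_by M \<X>). \<exists>A1\<in>sets (generated_by M \<X>). A = A1 \<inter> E \<union> (A0 - E)"
proof -
  let ?G = "sets (generated_by M \<X>)"
  have sub: "S \<subseteq> space M" if "S \<in> ?G" for S
    using sets.sets_into_space[OF that] by simp
  have "A \<in> sigma_sets (space M) (\<Union>X\<in>insert Y \<X>. events_of M X)"
    using A by (simp only: sets_generated_by)
  then show ?thesis
  proof (induction rule: sigma_sets.induct)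
    case (Basic A)
    show ?case
    proof (cases "\<exists>X\<in>\<X>. A \<in> events_of M X")
      case True
      then have "A \<in> ?G"
        by (auto simp: sets_generated_by)
      moreover have "A = A \<inter> E \<union> (A - E)"
        by blast
      ultimately show ?thesis
        by blast
    next
      case False
      then obtain S where S: "S \<in> sets borel" "A = Y -` S \<inter> space M"
        using Basic by (auto simp: events_of_eq)
      define A1 where "A1 = Z -` S \<inter> space M"
      \<comment> \<open>Off \<open>E\<close> the packet is zero, so only membership of
        \<open>0\<close> in \<open>S\<close> matters.\<close>
      define A0 where "A0 = (if 0 \<in> S then space M else {})"
      have "A1 \<in> ?G"
        using measurable_sets[OF Z S(1)] by (simp add: A1_def)
      moreover have "A0 \<in> ?G"
        using sets.top[of "generated_by M \<X>"] by (auto simp: A0_def)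
      moreover have "w \<in> A \<longleftrightarrow> w \<in> A1 \<inter> E \<union> (A0 - E)" for w
        using Y[of w] by (auto simp: S A1_def A0_def E_def)
      ultimately show ?thesis
        by blast
    qed
  next
    case Empty
    then show ?case
      by (intro bexI[of _ "{}"]) auto
  next
    case (Compl A)
    then obtain A0 A1 where *: "A0 \<in> ?G" "A1 \<in> ?G" "A = A1 \<inter> E \<union> (A0 - E)"
      by blast
    then have "space M - A = (space M - A1) \<inter> E \<union> ((space M - A0) - E)"
      by (auto simp: E_def)
    moreover have "space M - A0 \<in> ?G" "space M - A1 \<in> ?G"
      using sets.compl_sets[OF *(1)] sets.compl_sets[OF *(2)] by simp_all
    ultimately show ?case
      by blast
  next
    case (Union A)
    then obtain A0 A1 where *: "\<And>i. A0 i \<in> ?G" "\<And>i. A1 i \<in> ?G" "\<And>i. A i = A1 i \<inter> E \<union> (A0 i - E)"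
      by metis
    have "(\<Union>i. A i) = (\<Union>i. A1 i) \<inter> E \<union> ((\<Union>i. A0 i) - E)"
      by (auto simp: *(3))
    moreover have "(\<Union>i. A0 i) \<in> ?G" "(\<Union>i. A1 i) \<in> ?G"
      using * by (auto intro: sets.countable_UN)
    ultimately show ?case
      by blast
  qed
qed

section \<open>The past and its independence from the current packet\<close>

definition data_events ::
  "'w measure \<Rightarrow> ('w \<Rightarrow> real^'n) \<Rightarrow> (nat \<Rightarrow> 'w \<Rightarrow> real^'n) \<Rightarrow> (nat \<Rightarrow> 'w \<Rightarrow> real) \<Rightarrow> source \<Rightarrow> 'w set set" where
  "data_events M x0 v \<eta> s = (case s of
      Init \<Rightarrow> events_of M x0 | Noise k \<Rightarrow> events_of M (v k) | Channel k \<Rightarrow> events_of M (\<eta> k))"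

text \<open>Noise of all times is included, channels only before \<open>k\<close>: the state and the
  local estimate at time \<open>k\<close> are measurable, while \<open>\<eta> k\<close> stays
  independent.\<close>

definition past ::
  "'w measure \<Rightarrow> ('w \<Rightarrow> real^'n) \<Rightarrow> (nat \<Rightarrow> 'w \<Rightarrow> real^'n) \<Rightarrow> (nat \<Rightarrow> 'w \<Rightarrow> real) \<Rightarrow> nat \<Rightarrow> 'w measure" where
  "past M x0 v \<eta> k =
     sigma (space M) (\<Union>s\<in>insert Init (range Noise \<union> Channel ` {..<k}). data_events M x0 v \<eta> s)"

lemma space_past [simp]: "space (past M x0 v \<eta> k) = space M"
  by (simp add: past_def space_measure_of_conv)

lemma sets_past: "sets (past M x0 v \<eta> k) =
    sigma_sets (space M) (\<Union>s\<in>insert Init (range Noise \<union> Channel ` {..<k}). data_events M x0 v \<eta> s)"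
  unfolding past_def
  by (rule sets_measure_of) (auto simp: events_of_eq data_events_def split: source.splits)

lemma past_mono: "j \<le> k \<Longrightarrow> sets (past M x0 v \<eta> j) \<subseteq> sets (past M x0 v \<eta> k)"
  unfolding sets_past by (intro sigma_sets_mono') auto

lemma measurable_past:
  "x0 \<in> borel_measurable (past M x0 v \<eta> k)"
  "v j \<in> borel_measurable (past M x0 v \<eta> k)"
  "j < k \<Longrightarrow> \<eta> j \<in> borel_measurable (past M x0 v \<eta> k)"
proof -
  have *: "data_events M x0 v \<eta> s \<subseteq> sets (past M x0 v \<eta> k)"
    if "s \<in> insert Init (range Noise \<union> Channel ` {..<k})" for s
    using that unfolding sets_past by blast
  show "x0 \<in> borel_measurable (past M x0 v \<eta> k)"
    using *[of Init] by (intro measurable_if_events_of[of M]) (auto simp: data_events_def)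
  show "v j \<in> borel_measurable (past M x0 v \<eta> k)"
    using *[of "Noise j"] by (intro measurable_if_events_of[of M]) (auto simp: data_events_def)
  show "\<eta> j \<in> borel_measurable (past M x0 v \<eta> k)" if "j < k"
    using *[of "Channel j"] that by (intro measurable_if_events_of[of M]) (auto simp: data_events_def)
qed

lemma random_data_indep_sets:
  assumes "random_data M x0 v \<eta> Qv p"
  shows "prob_space.indep_sets M (data_events M x0 v \<eta>) UNIV"
proof -
  have "(\<lambda>s. case s of Init \<Rightarrow> events_of M x0 | Noise k \<Rightarrow> events_of M (v k)
      | Channel k \<Rightarrow> events_of M (\<eta> k)) = data_events M x0 v \<eta>"
    by (simp add: data_events_def fun_eq_iff)
  then show ?thesis
    using assms by (simp add: random_data_def)
qed

lemma past_subset: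
  assumes "random_data M x0 v \<eta> Qv p"
  shows "sets (past M x0 v \<eta> k) \<subseteq> sets M"
proof -
  interpret prob_space M
    using assms by (simp add: random_data_def)
  show ?thesis
    using random_data_indep_sets[OF assms] unfolding sets_past indep_sets_def
    by (intro sets.sigma_sets_subset) auto
qed

text \<open>Disjoint groups of an independent family generate independent sigma-algebras. One group
  is everything that enters \<open>past\<close>, the other is \<open>Channel k\<close>
  alone.\<close>

lemma past_indep_channel:
  assumes rd: "random_data M x0 v \<eta> Qv p" and A: "A \<in> sets (past M x0 v \<eta> k)"
    and E: "E \<in> events_of M (\<eta> k)"
  shows "measure M (A \<inter> E) = measure M A * measure M E"
proof -
  interpret prob_space M
    using rd by (simp add: random_data_def)
  define I where "I = case_bool (insert Init (range Noise \<union> Channel ` {..<k})) {Channel k}"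
  have "indep_sets (\<lambda>j. sigma_sets (space M) (\<Union>i\<in>I j. data_events M x0 v \<eta> i)) UNIV"
  proof (rule indep_sets_collect_sigma)
    show "indep_sets (data_events M x0 v \<eta>) (\<Union>j\<in>UNIV. I j)"
      using random_data_indep_sets[OF rd] by (rule indep_sets_mono_index[rotated]) simp
    show "Int_stable (data_events M x0 v \<eta> i)" for i
      by (auto simp: data_events_def Int_stable_events_of split: source.split)
    show "disjoint_family_on I UNIV"
      by (auto simp: disjoint_family_on_def I_def split: bool.splits)
  qed
  moreover have "(\<lambda>j. sigma_sets (space M) (\<Union>i\<in>I j. data_events M x0 v \<eta> i)) =
      case_bool (sets (past M x0 v \<eta> k)) (sigma_sets (space M) (events_of M (\<eta> k)))"
    by (auto simp: fun_eq_iff I_def sets_past data_events_def split: bool.splits)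
  ultimately have "indep_set (sets (past M x0 v \<eta> k)) (sigma_sets (space M) (events_of M (\<eta> k)))"
    by (simp add: indep_set_def)
  then show ?thesis
    using A E by (intro indep_setD[OF _ A sigma_sets.Basic])
qed

lemma gaussian_integrable:
  fixes X :: "'w \<Rightarrow> real^'n"
  assumes "prob_space M" "gaussian M X m \<Sigma>"
  shows "integrable M X"
proof (rule integrable_vec_lambda)
  fix i
  interpret prob_space M
    by fact
  have X: "X \<in> borel_measurable M"
    using assms by (simp add: gaussian_def)
  let ?a = "axis i 1 :: real^'n"
  define c s where "c = ?a \<bullet> m" and "s = ?a \<bullet> (\<Sigma> *v ?a)"
  have law: "distr M borel (\<lambda>w. ?a \<bullet> X w) = normal_law c s" and s: "s \<ge> 0"
    using assms by (auto simp: gaussian_def psd_def c_def s_def)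
  have "integrable (normal_law c s) (\<lambda>x. x)"
  proof (cases "s = 0")
    case True
    have "integrable (return borel c) (\<lambda>x. x) \<longleftrightarrow> integrable (return borel c) (\<lambda>x. c)"
      by (intro integrable_cong_AE) (auto simp: AE_return)
    moreover have "integrable (return borel c) (\<lambda>x. c)"
      by (intro finite_measure.integrable_const prob_space.finite_measure prob_space_return) simp
    ultimately show ?thesis
      using True by (simp add: normal_law_def)
  next
    case False
    then have "integrable lborel (\<lambda>x. normal_density c (sqrt s) x * x)"
      using s by (intro integrable_normal_moment_nz_1) simp
    then show ?thesis
      using False by (simp add: normal_law_def integrable_density)
  qed
  then have "integrable M (\<lambda>w. ?a \<bullet> X w)"
    unfolding law[symmetric] using X by (subst (asm) integrable_distr_eq) auto
  then show "integrable M (\<lambda>w. X w $ i)"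
    by (simp add: inner_axis')
qed

lemma measurable_mono_sets:
  "X \<in> borel_measurable F \<Longrightarrow> space F = space F' \<Longrightarrow> sets F \<subseteq> sets F' \<Longrightarrow> X \<in> borel_measurable F'"
  using measurable_mono[of borel borel F F'] by auto

text \<open>An estimate at time \<open>k\<close> depends on all earlier observations, so the
  recursion carries these along with the state. The local estimate is formed before the packet,
  which removes the circularity; afterwards the packet is shown to add nothing to it.\<close>

lemma closed_loop_run_exists:
  fixes A C :: "real^'n^'n" and BL :: "real^'l^'n" and BR :: "real^'r^'n"
    and K0 K0' :: "real^'n^('l + 'r)" and F0 :: "real^'n^'l" and M :: "'w measure"
  assumes rd: "random_data M x0 v \<eta> Qv p"
    and \<eta>: "\<And>k w. w \<in> space M \<Longrightarrow> \<eta> k w \<in> {0, 1}"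
  obtains U uL x yL yR xL xR where
    "system_run A BL BR C M x0 v \<eta> U uL x yL yR xL xR"
    "\<And>k w. U k w = - (K0 *v xR k w) - K0' *v (\<integral>w'. xR k w' \<partial>M)"
    "\<And>k w. uL k w = - (F0 *v (xL k w - xR k w))"
proof -
  interpret prob_space M
    using rd by (simp add: random_data_def)
  \<comment> \<open>The triple \<open>s\<close> stands for \<open>x k\<close>, the local
    observations up to time \<open>k\<close> and the packets before time \<open>k\<close>. Thus
    \<open>est\<close> conditions on what is known before \<open>pkt k s\<close>, and
    \<open>rest\<close> on the packets including it.\<close>
  define est where "est s = vec_cond_exp M (generated_by M (fst (snd s) \<union> snd (snd s))) (fst s)"
    for s :: "('w \<Rightarrow> real^'n) \<times> ('w \<Rightarrow> real^'n) set \<times> ('w \<Rightarrow> real^'n) set"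
  define pkt where "pkt k s = (\<lambda>w. \<eta> k w *\<^sub>R est s w)" for k s
  define rest where "rest k s = vec_cond_exp M (generated_by M (insert (pkt k s) (snd (snd s)))) (fst s)" for k s
  define Uc where "Uc k s = (\<lambda>w. - (K0 *v rest k s w) - K0' *v (\<integral>w'. rest k s w' \<partial>M))" for k s
  define uc where "uc k s = (\<lambda>w. - (F0 *v (est s w - rest k s w)))" for k s
  define nx where "nx k s = (\<lambda>w. A *v fst s w + row_block BL BR *v Uc k s w + BL *v uc k s w)" for k s
  define st where "st = rec_nat (x0, {\<lambda>w. C *v x0 w + v 0 w}, {})
    (\<lambda>k s. (nx k s, insert (\<lambda>w. C *v nx k s w + v (Suc k) w) (fst (snd s)), insert (pkt k s) (snd (snd s))))"
  define x yL xL yR xR U uL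
    where "x k = fst (st k)" and "yL k = (\<lambda>w. C *v x k w + v k w)" and "xL k = est (st k)"
      and "yR k = pkt k (st k)" and "xR k = rest k (st k)" and "U k = Uc k (st k)" and "uL k = uc k (st k)"
    for k
  have st0: "st 0 = (x0, {\<lambda>w. C *v x0 w + v 0 w}, {})"
    by (simp add: st_def)
  have stS: "st (Suc k) = (nx k (st k), insert (\<lambda>w. C *v nx k (st k) w + v (Suc k) w) (fst (snd (st k))),
      insert (pkt k (st k)) (snd (snd (st k))))" for k
    by (simp add: st_def)
  have x0: "x 0 = x0" and xS: "x (Suc k) = (\<lambda>w. A *v x k w + row_block BL BR *v U k w + BL *v uL k w)" for k
    by (simp_all add: x_def st0 stS nx_def U_def uL_def)
  have SL: "fst (snd (st k)) = yL ` {..k}" for k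
    by (induction k) (simp_all add: st0 stS yL_def x_def atMost_Suc)
  have SR: "snd (snd (st k)) = yR ` {..<k}" for k
    by (induction k) (simp_all add: st0 stS yR_def lessThan_Suc)
  define G where "G k = generated_by M (yL ` {..k} \<union> yR ` {..<k})" for k
  have xL: "xL k = vec_cond_exp M (G k) (x k)" for k
    by (simp add: xL_def est_def SL SR G_def x_def)
  have yR: "yR k = (\<lambda>w. \<eta> k w *\<^sub>R xL k w)" for k
    by (simp add: yR_def pkt_def xL_def)
  have atMost_k: "{..k} = insert k {..<k}" for k :: nat
    by auto
  have xR: "xR k = vec_cond_exp M (remote_info M yR k) (x k)" for k
    by (simp add: xR_def rest_def SR remote_info_def x_def atMost_k yR_def[symmetric])
  have U: "U k = (\<lambda>w. - (K0 *v xR k w) - K0' *v (\<integral>w'. xR k w' \<partial>M))"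
    and uL: "uL k = (\<lambda>w. - (F0 *v (xL k w - xR k w)))" for k
    by (simp_all add: U_def Uc_def uL_def uc_def xR_def xL_def)
  let ?H = "past M x0 v \<eta>"
  note mp = measurable_past(1)[of x0 M v \<eta>] measurable_past(2)[of v _ M x0 \<eta>]
    measurable_past(3)[of _ _ \<eta> M x0 v]
  have H: "sets (?H k) \<subseteq> events" for k
    by (rule past_subset[OF rd])
  have lift: "X \<in> borel_measurable (?H k)" if "X \<in> borel_measurable (?H j)" "j \<le> k"
    for X :: "'w \<Rightarrow> real^'n" and j k
    using past_mono[OF that(2), of M x0 v \<eta>] by (intro measurable_mono_sets[OF that(1)]) auto
  have integrable_x0: "integrable M x0"
    using rd gaussian_integrable[OF prob_space_axioms] by (auto simp: random_data_def)
  \<comment> \<open>Everything listed here is measurable without \<open>\<eta> k\<close>; this is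
    what later makes the packet arrival uninformative about \<open>x k\<close>.\<close>
  have inv: "x k \<in> borel_measurable (?H k) \<and> integrable M (x k) \<and>
      (\<forall>j\<le>k. yL j \<in> borel_measurable (?H k)) \<and> (\<forall>j<k. yR j \<in> borel_measurable (?H k)) \<and>
      xL k \<in> borel_measurable (?H k)" for k
  proof (induction k)
    case 0
    have yL0: "yL 0 \<in> borel_measurable (?H 0)"
      unfolding yL_def x0 by (intro borel_measurable_add borel_measurable_matrix mp)
    have "sets (G 0) \<subseteq> sets (?H 0)"
      unfolding G_def using yL0 by (intro generated_by_subset) auto
    then have "xL 0 \<in> borel_measurable (?H 0)"
      unfolding xL by (intro measurable_mono_sets[OF measurable_vec_cond_exp]) (auto simp: G_def)
    then show ?case
      using integrable_x0 yL0 by (simp add: x0 mp)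
  next
    case (Suc k)
    have yR_k: "yR k \<in> borel_measurable (?H (Suc k))"
      unfolding yR using lift[of "xL k" k "Suc k"] Suc.IH
      by (intro borel_measurable_scaleR mp) auto
    have yR_S: "yR j \<in> borel_measurable (?H (Suc k))" if "j < Suc k" for j
    proof (cases "j = k")
      case False
      then show ?thesis
        using that Suc.IH by (intro lift[of "yR j" k "Suc k"]) simp_all
    qed (use yR_k in simp)
    have G_k: "sets (G k) \<subseteq> sets (?H k)"
      unfolding G_def using Suc.IH by (intro generated_by_subset) auto
    have remote: "sets (remote_info M yR k) \<subseteq> sets (?H (Suc k))"
      unfolding remote_info_def using yR_S by (intro generated_by_subset) auto
    have int_x: "integrable M (x k)"
      using Suc.IH by simp
    have int_xL: "integrable M (xL k)"
      unfolding xL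
      by (intro integrable_vec_cond_exp int_x order.trans[OF G_k H]) (simp add: G_def)
    have int_xR: "integrable M (xR k)"
      unfolding xR
      by (intro integrable_vec_cond_exp int_x order.trans[OF remote H]) (simp add: remote_info_def)
    have xR_k: "xR k \<in> borel_measurable (?H (Suc k))"
      unfolding xR by (intro measurable_mono_sets[OF measurable_vec_cond_exp _ remote]) (simp add: remote_info_def)
    have x_k: "x k \<in> borel_measurable (?H (Suc k))" "xL k \<in> borel_measurable (?H (Suc k))"
      using lift[of "x k" k "Suc k"] lift[of "xL k" k "Suc k"] Suc.IH by simp_all
    have x_S: "x (Suc k) \<in> borel_measurable (?H (Suc k))"
      unfolding xS U uL
      by (intro borel_measurable_add borel_measurable_matrix borel_measurable_diff borel_measurable_uminus
          x_k xR_k borel_measurable_const)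
    have yL_S: "yL (Suc k) \<in> borel_measurable (?H (Suc k))"
      unfolding yL_def by (intro borel_measurable_add borel_measurable_matrix mp x_S)
    have yL_S': "yL j \<in> borel_measurable (?H (Suc k))" if "j \<le> Suc k" for j
    proof (cases "j = Suc k")
      case False
      then show ?thesis
        using that Suc.IH by (intro lift[of "yL j" k "Suc k"]) simp_all
    qed (use yL_S in simp)
    have "sets (G (Suc k)) \<subseteq> sets (?H (Suc k))"
      unfolding G_def using yL_S' yR_S by (intro generated_by_subset) auto
    then have "xL (Suc k) \<in> borel_measurable (?H (Suc k))"
      unfolding xL by (intro measurable_mono_sets[OF measurable_vec_cond_exp]) (auto simp: G_def)
    moreover have "integrable M (x (Suc k))"
    proof -
      have "integrable M (\<lambda>w. - (K0 *v xR k w) - K0' *v (\<integral>w'. xR k w' \<partial>M))"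
        using integrable_matrix[OF int_xR, of K0] by simp
      moreover have "integrable M (\<lambda>w. - (F0 *v (xL k w - xR k w)))"
        using integrable_matrix[OF Bochner_Integration.integrable_diff[OF int_xL int_xR], of F0] by simp
      ultimately show ?thesis
        unfolding xS U uL
        by (rule Bochner_Integration.integrable_add[OF Bochner_Integration.integrable_add
              [OF integrable_matrix[OF int_x] integrable_matrix] integrable_matrix])
    qed
    ultimately show ?case
      using x_S yL_S' yR_S by blast
  qed
  have G_H: "sets (G k) \<subseteq> sets (?H k)" for k
    unfolding G_def using inv[of k] by (intro generated_by_subset) auto
  have local_eq: "local_info M yL yR k = generated_by M (insert (yR k) (yL ` {..k} \<union> yR ` {..<k}))" for k
    by (simp add: local_info_def atMost_k[of k])
  \<comment> \<open>Local information is \<open>G k\<close> enlarged by \<open>yR k\<close>. The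
    packet repeats \<open>xL k\<close>, known from \<open>G k\<close>, and beyond that can only
    reveal the independent event \<open>E\<close>.\<close>
  have "is_cond_exp M (local_info M yL yR k) (x k) (xL k)" for k
  proof -
    define E where "E = {w \<in> space M. \<eta> k w = 1}"
    have E_ev: "E \<in> events_of M (\<eta> k)"
      by (auto simp: E_def events_of_eq intro!: exI[of _ "{1}"])
    have \<eta>_meas: "\<eta> k \<in> borel_measurable (?H (Suc k))"
      by (intro mp) simp
    have E: "E \<in> events"
      using E_ev events_of_subset[OF measurable_mono_sets[OF \<eta>_meas _ H]] by auto
    have G_sub: "sets (G k) \<subseteq> sets (local_info M yL yR k)"
      unfolding G_def local_eq by (intro generated_by_mono) auto
    have "yR k \<in> borel_measurable (?H (Suc k))"
      using inv[of "Suc k"] by simp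
    then have "sets (local_info M yL yR k) \<subseteq> sets (?H (Suc k))"
      unfolding local_eq using inv[of "Suc k"] by (intro generated_by_subset) auto
    then have L_sub: "sets (local_info M yL yR k) \<subseteq> events"
      using H by blast
    have xL_G: "xL k \<in> borel_measurable (G k)"
      unfolding xL by (rule measurable_vec_cond_exp)
    have "AE w in M. real_cond_exp M (local_info M yL yR k) (\<lambda>w. x k w $ i) w =
        real_cond_exp M (G k) (\<lambda>w. x k w $ i) w" for i
    proof (rule real_cond_exp_indep_event)
      show "integrable M (\<lambda>w. x k w $ i)"
        using inv integrable_vec_nth by blast
      show "(\<lambda>w. x k w $ i) \<in> borel_measurable (?H k)"
        using inv measurable_compose[OF _ borel_measurable_vec_nth] by blast
      show "\<And>A. A \<in> sets (?H k) \<Longrightarrow> prob (A \<inter> E) = prob A * prob E"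
        using past_indep_channel[OF rd _ E_ev] .
      show "\<exists>A0\<in>sets (G k). \<exists>A1\<in>sets (G k). S = A1 \<inter> E \<union> (A0 - E)"
        if "S \<in> sets (local_info M yL yR k)" for S
        using that \<eta> unfolding E_def G_def local_eq
        by (intro generated_by_insert_packet[of "xL k" _ _ "\<eta> k" "yR k"] xL_G[unfolded G_def]) (auto simp: yR)
    qed (use H G_H G_sub L_sub E in \<open>auto simp: G_def local_info_def\<close>)
    then have "AE w in M. \<forall>i. real_cond_exp M (local_info M yL yR k) (\<lambda>w. x k w $ i) w =
        real_cond_exp M (G k) (\<lambda>w. x k w $ i) w"
      by (simp add: AE_all_countable)
    moreover have "xL k \<in> borel_measurable (local_info M yL yR k)"
      using xL_G by (rule measurable_mono_sets) (use G_sub in \<open>auto simp: G_def local_info_def\<close>)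
    ultimately show ?thesis
      unfolding is_cond_exp_def by (auto simp: xL vec_cond_exp_def elim!: eventually_mono)
  qed
  moreover have "is_cond_exp M (remote_info M yR k) (x k) (xR k)" for k
    unfolding xR by (rule is_cond_exp_vec_cond_exp)
  moreover have "xL k \<in> borel_measurable (generated_by M (yL ` {..k} \<union> yR ` {..<k}))" for k
    unfolding xL G_def by (rule measurable_vec_cond_exp)
  ultimately have "system_run A BL BR C M x0 v \<eta> U uL x yL yR xL xR"
    unfolding system_run_def by (auto simp: x0 xS yR yL_def)
  then show ?thesis
    using that U uL by (metis (no_types, lifting))
qed

section \<open>Gaussian laws with prescribed covariance\<close>

definition outer :: "real^'n \<Rightarrow> real^'n^'n" where
  "outer w = (\<chi> i j. w $ i * w $ j)"

lemma outer_mult: "outer w *v y = (w \<bullet> y) *\<^sub>R w"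
  by (simp add: outer_def matrix_vector_mult_def vec_eq_iff inner_vec_def sum_distrib_left mult_ac)

lemma transpose_outer: "transpose (outer w) = outer w"
  by (simp add: outer_def transpose_def vec_eq_iff mult.commute)

text \<open>The form along the line \<open>x + t *\<^sub>R y\<close> is a nonnegative polynomial of
  degree at most two in \<open>t\<close>.\<close>

lemma psd_cauchy_schwarz:
  assumes "psd Q"
  shows "(x \<bullet> (Q *v y))\<^sup>2 \<le> (x \<bullet> (Q *v x)) * (y \<bullet> (Q *v y))"
proof -
  have sym: "y \<bullet> (Q *v x) = x \<bullet> (Q *v y)"
    using assms by (intro inner_symmetric) (simp add: psd_def)
  define a b c where "a = y \<bullet> (Q *v y)" and "b = x \<bullet> (Q *v y)" and "c = x \<bullet> (Q *v x)"
  have "0 \<le> a * t\<^sup>2 + 2 * b * t + c" for t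
  proof -
    have "0 \<le> (x + t *\<^sub>R y) \<bullet> (Q *v (x + t *\<^sub>R y))"
      using assms by (simp only: psd_def)
    also have "\<dots> = a * t\<^sup>2 + 2 * b * t + c"
      by (simp add: a_def b_def c_def matrix_vector_right_distrib matrix_vector_mult_scaleR
          inner_add_left inner_add_right sym power2_eq_square algebra_simps)
    finally show ?thesis .
  qed
  note quad = this
  have a: "a \<ge> 0"
    using assms by (simp add: psd_def a_def)
  have "b\<^sup>2 \<le> c * a"
  proof (cases "a = 0")
    case True
    have "b = 0"
    proof (rule ccontr)
      assume "b \<noteq> 0"
      \<comment> \<open>With \<open>a = 0\<close> the polynomial is linear and takes the value
        \<open>-1\<close> at the chosen point.\<close>
      then show False
        using quad[of "- (c + 1) / (2 * b)"] True by (simp add: field_simps)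
    qed
    then show ?thesis
      using True by simp
  next
    case False
    \<comment> \<open>The point \<open>- b / a\<close> minimises the polynomial.\<close>
    then have "a * (a * (- b / a)\<^sup>2 + 2 * b * (- b / a) + c) = c * a - b\<^sup>2"
      by (simp add: field_simps power2_eq_square)
    then show ?thesis
      using mult_nonneg_nonneg[OF a quad[of "- b / a"]] by simp
  qed
  then show ?thesis
    by (simp add: a_def b_def c_def)
qed

lemma psd_eq_zero:
  assumes "psd Q" "\<And>x. x \<bullet> (Q *v x) = 0"
  shows "Q = 0"
proof -
  have "x \<bullet> (Q *v y) = 0" for x y
    using psd_cauchy_schwarz[OF assms(1), of x y] assms(2) by simp
  then show ?thesis
    by (simp add: vec_eq_iff matrix_vector_nth_axis)
qed

text \<open>Subtracting \<open>outer (Q *v x) / (x \<bullet> (Q *v x))\<close> keeps \<open>Q\<close> semidefinite and adds \<open>x\<close> to its kernel.\<close>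

lemma psd_induct [consumes 1, case_names zero outer]:
  fixes Q :: "real^'n^'n"
  assumes "psd Q" and zero: "P 0"
    and step: "\<And>Q w. psd Q \<Longrightarrow> P Q \<Longrightarrow> P (Q + outer w)"
  shows "P Q"
  using assms(1)
proof (induction "CARD('n) - dim {y. Q *v y = 0}" arbitrary: Q rule: less_induct)
  case less
  show ?case
  proof (cases "Q = 0")
    case True
    then show ?thesis
      using zero by simp
  next
    case False
    then obtain x where x: "x \<bullet> (Q *v x) \<noteq> 0"
      using psd_eq_zero less.prems by blast
    define q where "q = x \<bullet> (Q *v x)"
    have q: "q > 0"
      using x less.prems by (simp add: q_def psd_def less_le)
    have sym: "y \<bullet> (Q *v z) = z \<bullet> (Q *v y)" for y z
      using less.prems by (intro inner_symmetric) (simp add: psd_def)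
    define w where "w = (1 / sqrt q) *\<^sub>R (Q *v x)"
    define Q' where "Q' = Q - outer w"
    have Q'_mult: "Q' *v y = Q *v y - ((x \<bullet> (Q *v y)) / q) *\<^sub>R (Q *v x)" for y
      using q by (simp add: Q'_def matrix_vector_mult_diff_rdistrib outer_mult w_def sym[of x y]
          inner_commute[of "Q *v x"])
    have "psd Q'"
    proof (rule psdI)
      show "transpose Q' = Q'"
        using less.prems by (simp add: Q'_def transpose_diff transpose_outer psd_def)
      fix y
      \<comment> \<open>Semidefiniteness of \<open>Q'\<close> is the Cauchy-Schwarz inequality
        divided by \<open>q\<close>.\<close>
      show "0 \<le> y \<bullet> (Q' *v y)"
        using psd_cauchy_schwarz[OF less.prems, of x y] q
        by (simp add: Q'_mult inner_diff_right sym[of y x] q_def[symmetric] field_simps power2_eq_square)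
    qed
    have sub: "subspace {y. T *v y = 0}" for T :: "real^'n^'n"
      by (simp add: subspace_def matrix_vector_right_distrib matrix_vector_mult_scaleR)
    have "{y. Q *v y = 0} \<subseteq> {y. Q' *v y = 0}"
      by (auto simp: Q'_mult)
    moreover have "x \<in> {y. Q' *v y = 0}" "x \<notin> {y. Q *v y = 0}"
      using x q by (auto simp: Q'_mult q_def)
    ultimately have "dim {y. Q *v y = 0} < dim {y. Q' *v y = 0}"
      using sub by (intro dim_psubset) (auto simp: span_eq_iff[THEN iffD2])
    moreover have "dim {y. Q' *v y = 0} \<le> CARD('n)"
      using dim_subset_UNIV_cart by blast
    ultimately have "P Q'"
      using \<open>psd Q'\<close> by (intro less.hyps) auto
    then show ?thesis
      using step[OF \<open>psd Q'\<close>, of w] by (simp add: Q'_def)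
  qed
qed

text \<open>At variance zero \<open>normal_law\<close> is a point mass, whereas the addition theorem
  concerns densities. A summand of variance zero vanishes almost surely and is treated
  apart.\<close>

lemma normal_law_add:
  assumes "prob_space M" and ind: "prob_space.indep_var M borel X borel Y"
    and X: "distr M borel X = normal_law 0 s" "s \<ge> 0" and Y: "distr M borel Y = normal_law 0 t" "t \<ge> 0"
  shows "distr M borel (\<lambda>w. X w + Y w) = normal_law 0 (s + t)"
proof -
  interpret prob_space M
    by fact
  have [measurable]: "X \<in> borel_measurable M" "Y \<in> borel_measurable M"
    using indep_var_rv1[OF ind] indep_var_rv2[OF ind] by auto
  have null: "AE w in M. V w = 0" if "distr M borel V = normal_law 0 0" "V \<in> borel_measurable M" for V
  proof -
    have "distr M borel V = return borel 0"
      using that(1) by (simp add: normal_law_def)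
    have "AE x in return borel (0::real). x = 0"
      by (subst AE_return) auto
    then have "AE x in distr M borel V. x = 0"
      unfolding \<open>distr M borel V = return borel 0\<close> .
    then show ?thesis
      using that(2) by (subst (asm) AE_distr_iff) auto
  qed
  have dist: "distributed M lborel V (normal_density 0 (sqrt r))"
    if "distr M borel V = normal_law 0 r" "V \<in> borel_measurable M" "r > 0" for V r
  proof -
    have "distr M lborel V = distr M borel V"
      by (rule distr_cong) auto
    then show ?thesis
      using that by (simp add: distributed_def normal_law_def)
  qed
  consider "s = 0" | "t = 0" | "s > 0" "t > 0"
    using X(2) Y(2) by fastforce
  then show ?thesis
  proof cases
    case 1
    then have "AE w in M. X w + Y w = Y w"
      using null[of X] X by auto
    then have "distr M borel (\<lambda>w. X w + Y w) = distr M borel Y"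
      by (intro distr_cong_AE) auto
    then show ?thesis
      using 1 Y by simp
  next
    case 2
    then have "AE w in M. X w + Y w = X w"
      using null[of Y] Y by auto
    then have "distr M borel (\<lambda>w. X w + Y w) = distr M borel X"
      by (intro distr_cong_AE) auto
    then show ?thesis
      using 2 X by simp
  next
    case 3
    then have "distributed M lborel (\<lambda>w. X w + Y w) (normal_density (0 + 0) (sqrt ((sqrt s)\<^sup>2 + (sqrt t)\<^sup>2)))"
      using X Y by (intro add_indep_normal ind dist) auto
    then have "distr M lborel (\<lambda>w. X w + Y w) = normal_law 0 (s + t)"
      using 3 by (simp add: distributed_def normal_law_def)
    moreover have "distr M lborel (\<lambda>w. X w + Y w) = distr M borel (\<lambda>w. X w + Y w)"
      by (rule distr_cong) auto
    ultimately show ?thesis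
      by simp
  qed
qed

lemma prob_space_std_normal: "prob_space (density lborel std_normal_density)"
  by (rule prob_space_normal_density) simp

lemma normal_law_scale:
  "distr (density lborel std_normal_density) borel (\<lambda>g. g * t) = normal_law 0 (t\<^sup>2)"
proof (cases "t = 0")
  case True
  then show ?thesis
    using prob_space.distr_const[OF prob_space_std_normal, of 0 borel] by (simp add: normal_law_def)
next
  case False
  let ?N = "density lborel std_normal_density"
  interpret prob_space ?N
    by (rule prob_space_std_normal)
  have "distr ?N lborel (\<lambda>g. g) = ?N"
    by (rule distr_id2) simp
  then have "distributed ?N lborel (\<lambda>g. g) std_normal_density"
    by (simp add: distributed_def)
  then have "distributed ?N lborel (\<lambda>g. 0 + t * g) (normal_density (0 + t * 0) (\<bar>t\<bar> * 1))"
    using False by (intro normal_density_affine) auto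
  then have "distr ?N lborel (\<lambda>g. t * g) = normal_law 0 (t\<^sup>2)"
    using False by (simp add: distributed_def normal_law_def)
  moreover have "distr ?N lborel (\<lambda>g. t * g) = distr ?N borel (\<lambda>g. g * t)"
    by (rule distr_cong) (auto simp: mult.commute)
  ultimately show ?thesis
    by simp
qed

text \<open>Rank-one induction on the covariance: adding \<open>g *\<^sub>R w\<close>, with
  \<open>g\<close> standard normal and independent, changes the covariance from \<open>Q\<close> to
  \<open>Q + outer w\<close>. Singular matrices are thereby included.\<close>

lemma gaussian_law_exists:
  fixes Q :: "real^'n^'n"
  assumes "psd Q"
  obtains L :: "(real^'n) measure" where "prob_space L" "sets L = sets borel"
    "\<And>a. distr L borel (\<lambda>x. a \<bullet> x) = normal_law 0 (a \<bullet> (Q *v a))"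
  using assms
proof (induction Q arbitrary: thesis rule: psd_induct)
  case zero
  have "prob_space (return borel (0 :: real^'n))"
    by (rule prob_space_return) simp
  moreover have "distr (return borel 0) borel (\<lambda>x. a \<bullet> x) = normal_law 0 (a \<bullet> (0 *v a))" for a :: "real^'n"
    by (simp add: distr_return normal_law_def)
  ultimately show ?case
    by (intro zero[of "return borel 0"]) auto
next
  case (outer Q w)
  obtain L :: "(real^'n) measure" where L: "prob_space L" "sets L = sets borel"
    "\<And>a. distr L borel (\<lambda>x. a \<bullet> x) = normal_law 0 (a \<bullet> (Q *v a))"
    using outer.IH by blast
  let ?N = "density lborel std_normal_density"
  let ?P = "L \<Otimes>\<^sub>M ?N"
  define f where "f z = fst z + snd z *\<^sub>R w" for z :: "(real^'n) \<times> real"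
  interpret L: prob_space L
    by fact
  interpret N: prob_space ?N
    by (rule prob_space_std_normal)
  interpret P: pair_prob_space L ?N ..
  have sets_P: "sets ?P = sets (borel \<Otimes>\<^sub>M borel)"
    using L(2) by (intro sets_pair_measure_cong) auto
  have meas_P: "g \<in> borel_measurable ?P \<longleftrightarrow> g \<in> borel_measurable (borel \<Otimes>\<^sub>M borel)"
    for g :: "(real^'n) \<times> real \<Rightarrow> 'b::topological_space"
    by (simp only: measurable_cong_sets[OF sets_P refl])
  have f: "f \<in> borel_measurable ?P"
    unfolding meas_P f_def by measurable
  have [simp]: "distr ?P L fst = L"
    by (simp add: N.distr_pair_fst N.emeasure_space_1)
  have [simp]: "distr ?P ?N snd = ?N"
  proof (rule measure_eqI)
    fix S assume "S \<in> sets (distr ?P ?N snd)"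
    then have S: "S \<in> sets ?N"
      by simp
    then have "emeasure (distr ?P ?N snd) S = emeasure ?P (snd -` S \<inter> space ?P)"
      by (intro emeasure_distr measurable_snd)
    also have "snd -` S \<inter> space ?P = space L \<times> S"
      using sets.sets_into_space[OF S] by (auto simp: space_pair_measure)
    also have "emeasure ?P \<dots> = emeasure ?N S"
      using N.emeasure_pair_measure_Times[OF sets.top[of L] S] by (simp add: L.emeasure_space_1)
    finally show "emeasure (distr ?P ?N snd) S = emeasure ?N S" .
  qed simp
  have "distr (distr ?P borel f) borel (\<lambda>x. a \<bullet> x) = normal_law 0 (a \<bullet> ((Q + outer w) *v a))" for a
  proof -
    have ax: "(\<lambda>x. a \<bullet> x) \<in> borel_measurable L"
      using L(2) by (simp cong: measurable_cong_sets)
    have gt: "(\<lambda>g. g * (a \<bullet> w)) \<in> borel_measurable ?N"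
      by simp
    have law_x: "distr ?P borel ((\<lambda>x. a \<bullet> x) \<circ> fst) = normal_law 0 (a \<bullet> (Q *v a))"
      using distr_distr[OF ax measurable_fst, of ?N] by (simp add: L(3))
    have law_g: "distr ?P borel ((\<lambda>g. g * (a \<bullet> w)) \<circ> snd) = normal_law 0 ((a \<bullet> w)\<^sup>2)"
      using distr_distr[OF gt measurable_snd, of L] by (simp add: normal_law_scale)
    interpret Y: prob_space "distr ?N borel (\<lambda>g. g * (a \<bullet> w))"
      by (rule N.prob_space_distr[OF gt])
    \<comment> \<open>The joint law of the two summands is a product measure, which is their
      independence.\<close>
    have "distr L borel (\<lambda>x. a \<bullet> x) \<Otimes>\<^sub>M distr ?N borel (\<lambda>g. g * (a \<bullet> w)) =
        distr ?P (borel \<Otimes>\<^sub>M borel) (\<lambda>(x, g). (a \<bullet> x, g * (a \<bullet> w)))"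
      by (rule pair_measure_distr[OF ax gt Y.sigma_finite_measure_axioms])
    then have "P.indep_var borel ((\<lambda>x. a \<bullet> x) \<circ> fst) borel ((\<lambda>g. g * (a \<bullet> w)) \<circ> snd)"
      unfolding P.indep_var_distribution_eq
      using measurable_comp[OF measurable_fst ax, of ?N] measurable_comp[OF measurable_snd gt, of L]
      by (simp add: law_x[unfolded o_def] law_g[unfolded o_def] L(3) normal_law_scale o_def case_prod_beta')
    then have "distr ?P borel (\<lambda>z. ((\<lambda>x. a \<bullet> x) \<circ> fst) z + ((\<lambda>g. g * (a \<bullet> w)) \<circ> snd) z)
        = normal_law 0 (a \<bullet> (Q *v a) + (a \<bullet> w)\<^sup>2)"
      using outer.hyps law_x law_g by (intro normal_law_add P.prob_space_axioms) (auto simp: psd_def o_def)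
    moreover have "distr (distr ?P borel f) borel (\<lambda>x. a \<bullet> x) = distr ?P borel (\<lambda>z. a \<bullet> f z)"
      using f by (subst distr_distr) (auto simp: o_def)
    ultimately show ?thesis
      by (simp add: f_def o_def inner_add_right matrix_vector_mult_add_rdistrib outer_mult
          power2_eq_square inner_commute)
  qed
  moreover have "prob_space (distr ?P borel f)"
    by (rule P.prob_space_distr[OF f])
  ultimately show ?case
    by (intro outer.prems[of "distr ?P borel f"]) auto
qed


section \<open>Random data on the sample space\<close>

lemma events_of_pullback:
  assumes "\<phi> \<in> measurable P N" "T \<in> events_of (distr P N \<phi>) X"
  shows "\<phi> -` T \<inter> space P \<in> events_of P (X \<circ> \<phi>)"
proof -
  obtain S where S: "S \<in> sets borel" "T = X -` S \<inter> space N"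
    using assms(2) by (auto simp: events_of_eq)
  then have "\<phi> -` T \<inter> space P = (X \<circ> \<phi>) -` S \<inter> space P"
    using measurable_space[OF assms(1)] by auto
  then show ?thesis
    using S(1) by (auto simp: events_of_eq)
qed

text \<open>Independent variables are easily obtained as coordinates of a product over
  \<open>source\<close>, but stabilizability refers to measures on the type \<open>sample\<close>.
  The data are transported there along \<open>\<phi>\<close>.\<close>

lemma random_data_distr:
  fixes \<phi> :: "'a \<Rightarrow> 'b" and x0 :: "'b \<Rightarrow> real^'n"
  assumes rd: "random_data P (x0 \<circ> \<phi>) (\<lambda>k. v k \<circ> \<phi>) (\<lambda>k. \<eta> k \<circ> \<phi>) Qv p"
    and \<phi>: "\<phi> \<in> measurable P N"
    and meas: "x0 \<in> borel_measurable N" "\<And>k. v k \<in> borel_measurable N" "\<And>k. \<eta> k \<in> borel_measurable N"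
  shows "random_data (distr P N \<phi>) x0 v \<eta> Qv p"
proof -
  let ?M = "distr P N \<phi>"
  interpret P: prob_space P
    using rd by (simp add: random_data_def)
  interpret M: prob_space ?M
    by (rule P.prob_space_distr[OF \<phi>])
  have gauss: "gaussian ?M X m \<Sigma>" if "gaussian P (X \<circ> \<phi>) m \<Sigma>" "X \<in> borel_measurable N"
    for X :: "'b \<Rightarrow> real^'n" and m \<Sigma>
  proof -
    have "(\<lambda>w. a \<bullet> X w) \<in> borel_measurable N" for a
      using that(2) by simp
    then show ?thesis
      using that \<phi> by (simp add: gaussian_def distr_distr o_def)
  qed
  have pull: "measure ?M S = measure P (\<phi> -` S \<inter> space P)" if "S \<in> sets N" for S
    using that \<phi> by (intro measure_distr) auto
  have bern: "bernoulli ?M (\<eta> k) p" for k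
  proof -
    have "{w \<in> space N. \<eta> k w = c} \<in> sets N" for c
      using meas(3)[of k] by measurable
    moreover have "\<phi> -` {w \<in> space N. \<eta> k w = c} \<inter> space P = {w \<in> space P. (\<eta> k \<circ> \<phi>) w = c}" for c
      using measurable_space[OF \<phi>] by auto
    ultimately have "measure ?M {w \<in> space ?M. \<eta> k w = c} = measure P {w \<in> space P. (\<eta> k \<circ> \<phi>) w = c}" for c
      by (simp add: pull)
    then show ?thesis
      using rd meas by (simp add: bernoulli_def random_data_def)
  qed
  have "M.indep_sets (data_events ?M x0 v \<eta>) UNIV"
  proof (rule M.indep_setsI)
    show sub: "data_events ?M x0 v \<eta> s \<subseteq> M.events" for s
      unfolding data_events_def using meas
      by (cases s) (simp_all only: source.case, (rule events_of_subset; simp)+)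
    fix S J
    assume J: "J \<noteq> {}" "J \<subseteq> UNIV" "finite J" "\<forall>j\<in>J. S j \<in> data_events ?M x0 v \<eta> j"
    let ?S = "\<lambda>j. \<phi> -` S j \<inter> space P"
    have ev: "S j \<in> sets N" if "j \<in> J" for j
      using J(4) that sub[of j] by auto
    have "\<forall>j\<in>J. ?S j \<in> data_events P (x0 \<circ> \<phi>) (\<lambda>k. v k \<circ> \<phi>) (\<lambda>k. \<eta> k \<circ> \<phi>) j"
      using J(4) by (auto simp: data_events_def split: source.splits intro!: events_of_pullback[OF \<phi>])
    then have "P.prob (\<Inter>j\<in>J. ?S j) = (\<Prod>j\<in>J. P.prob (?S j))"
      using J by (intro P.indep_setsD[OF random_data_indep_sets[OF rd]]) auto
    moreover have "(\<Inter>j\<in>J. ?S j) = \<phi> -` (\<Inter>j\<in>J. S j) \<inter> space P"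
      using J(1) by auto
    moreover have "(\<Inter>j\<in>J. S j) \<in> sets N"
      using J ev by (intro sets.finite_INT) auto
    ultimately show "M.prob (\<Inter>j\<in>J. S j) = (\<Prod>j\<in>J. M.prob (S j))"
      using ev by (simp add: pull)
  qed
  then have "M.indep_sets (\<lambda>s. case s of Init \<Rightarrow> events_of ?M x0 | Noise k \<Rightarrow> events_of ?M (v k)
      | Channel k \<Rightarrow> events_of ?M (\<eta> k)) UNIV"
    by (simp only: data_events_def[abs_def])
  moreover have "\<exists>m \<Sigma>. gaussian ?M x0 m \<Sigma>" "\<forall>k. gaussian ?M (v k) 0 Qv"
    using rd gauss meas unfolding random_data_def by blast+
  ultimately show ?thesis
    using bern M.prob_space_axioms by (simp add: random_data_def)
qed

text \<open>The density vanishes nowhere, so a null set of the normal law is a Lebesgue null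
  set.\<close>

lemma normal_law_pos:
  assumes S: "S \<in> sets borel" "emeasure lborel S \<noteq> 0"
  shows "measure (normal_law 0 1) S > 0"
proof -
  let ?N = "density lborel std_normal_density"
  interpret prob_space ?N
    by (rule prob_space_std_normal)
  have "emeasure ?N S \<noteq> 0"
  proof
    assume "emeasure ?N S = 0"
    then have "(\<integral>\<^sup>+x. ennreal (std_normal_density x) * indicator S x \<partial>lborel) = 0"
      using S by (simp add: emeasure_density)
    then have "AE x in lborel. ennreal (std_normal_density x) * indicator S x = 0"
      using S by (subst (asm) nn_integral_0_iff_AE) auto
    then have "AE x in lborel. x \<notin> S"
      by eventually_elim (auto simp: indicator_def normal_density_pos less_imp_neq[symmetric] split: if_splits)
    then show False
      using S AE_iff_measurable[of S lborel "\<lambda>x. x \<notin> S"] by auto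
  qed
  then show ?thesis
    by (simp add: normal_law_def emeasure_eq_measure zero_less_measure_iff)
qed

text \<open>The initial state is random only along \<open>axis i 1\<close>, so single outcomes start
  at multiples of this basis vector. Both signs are provided because differences of outcomes are
  taken later.\<close>

lemma random_data_exists:
  fixes Qv :: "real^'n^'n" and i :: 'n
  assumes "psd Qv" "0 \<le> p" "p \<le> 1"
  obtains M :: "'n sample measure" and x0 v \<eta> where "random_data M x0 v \<eta> Qv p"
    "\<And>k w. \<eta> k w \<in> {0, 1}" "\<And>w. x0 w = x0 w $ i *\<^sub>R axis i 1"
    "measure M {w \<in> space M. x0 w $ i \<ge> 1} > 0" "measure M {w \<in> space M. x0 w $ i \<le> -1} > 0"
proof -
  have "psd (mat 1 :: real^'n^'n)"
    by (simp add: psd_def)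
  then obtain L1 :: "(real^'n) measure" where L1: "prob_space L1" "sets L1 = sets borel"
    "\<And>a. distr L1 borel (\<lambda>x. a \<bullet> x) = normal_law 0 (a \<bullet> (mat 1 *v a))"
    using gaussian_law_exists by blast
  obtain L2 :: "(real^'n) measure" where L2: "prob_space L2" "sets L2 = sets borel"
    "\<And>a. distr L2 borel (\<lambda>x. a \<bullet> x) = normal_law 0 (a \<bullet> (Qv *v a))"
    using gaussian_law_exists assms(1) by blast
  define e :: "real^'n" where "e = axis i 1"
  \<comment> \<open>All factors of the product share the type \<open>real^'n\<close>, so a packet
    arrival is encoded as \<open>e\<close> or \<open>0\<close> and read off from coordinate
    \<open>i\<close>.\<close>
  define LB where "LB = distr (measure_pmf (bernoulli_pmf (1 - p))) borel (\<lambda>b. if b then e else 0)"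
  have LB: "prob_space LB"
    unfolding LB_def by (intro measure_pmf.prob_space_distr) simp
  define D where "D s = (case s of Init \<Rightarrow> L1 | Noise k \<Rightarrow> L2 | Channel k \<Rightarrow> LB)" for s
  have D: "prob_space (D s)" "sets (D s) = sets borel" for s
    using L1 L2 LB by (auto simp: D_def LB_def split: source.split)
  define P where "P = PiM UNIV D"
  interpret P: prob_space P
    unfolding P_def by (intro prob_space_PiM D)
  have coord: "(\<lambda>f. f s) \<in> measurable P (D s)" for s
    unfolding P_def by (rule measurable_component_singleton) simp
  have coord_borel: "(\<lambda>f. f s) \<in> borel_measurable P" for s
    using coord[of s] by (simp only: measurable_cong_sets[OF refl D(2)])
  have coord_law: "distr P (D s) (\<lambda>f. f s) = D s" for s
    unfolding P_def by (intro distr_PiM_component D) simp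
  have push: "distr P borel (\<lambda>f. h (f s)) = distr (D s) borel h"
    if "h \<in> borel_measurable borel" for h :: "real^'n \<Rightarrow> 'b::topological_space" and s
  proof -
    have "h \<in> borel_measurable (D s)"
      using that by (simp only: measurable_cong_sets[OF D(2) refl])
    then show ?thesis
      using distr_distr[OF _ coord[of s], of h borel] by (simp add: coord_law o_def)
  qed
  define \<phi> where "\<phi> f = (f Init, (\<lambda>k. f (Noise k)), (\<lambda>k. f (Channel k) $ i))" for f :: "source \<Rightarrow> real^'n"
  define N :: "'n sample measure" where
    "N = borel \<Otimes>\<^sub>M (PiM UNIV (\<lambda>_. borel) \<Otimes>\<^sub>M PiM UNIV (\<lambda>_. borel))"
  define x0 where "x0 w = (fst w $ i) *\<^sub>R e" for w :: "'n sample"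
  define v where "v k w = fst (snd w) k" for k and w :: "'n sample"
  \<comment> \<open>The values are forced into 0 and 1 at every outcome, not just almost surely,
    since the run is constructed pointwise.\<close>
  define \<eta> where "\<eta> k w = (if snd (snd w) k = 1 then 1 else 0 :: real)" for k and w :: "'n sample"
  define hx where "hx = (\<lambda>x :: real^'n. (x $ i) *\<^sub>R e)"
  define h\<eta> where "h\<eta> = (\<lambda>x :: real^'n. if x $ i = 1 then 1 else 0 :: real)"
  have x0\<phi>: "x0 \<circ> \<phi> = (\<lambda>f. hx (f Init))" and v\<phi>: "v k \<circ> \<phi> = (\<lambda>f. f (Noise k))"
    and \<eta>\<phi>: "\<eta> k \<circ> \<phi> = (\<lambda>f. h\<eta> (f (Channel k)))" for k
    by (auto simp: fun_eq_iff x0_def v_def \<eta>_def \<phi>_def hx_def h\<eta>_def)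
  note [measurable] = borel_measurable_vec_nth
  have hx: "hx \<in> borel_measurable borel" and h\<eta>: "h\<eta> \<in> borel_measurable borel"
    unfolding hx_def h\<eta>_def by measurable
  have nth_coord: "(\<lambda>f. f s $ i) \<in> borel_measurable P" for s
    by (rule measurable_compose[OF coord_borel borel_measurable_vec_nth])
  have \<phi>: "\<phi> \<in> measurable P N"
    unfolding \<phi>_def N_def
    by (intro measurable_Pair measurable_PiM_single' coord_borel nth_coord) auto
  have meas: "x0 \<in> borel_measurable N" "v k \<in> borel_measurable N" "\<eta> k \<in> borel_measurable N" for k
    unfolding N_def x0_def v_def \<eta>_def by measurable
  have law_i: "distr P borel (\<lambda>f. f Init $ i) = density lborel std_normal_density"
  proof -
    have "distr P borel (\<lambda>f. f Init $ i) = distr L1 borel (\<lambda>x. x $ i)"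
      using push[of "\<lambda>x. x $ i" Init] by (simp add: D_def)
    also have "\<dots> = normal_law 0 1"
      using L1(3)[of "axis i 1"] by (simp add: inner_axis' inner_axis_axis)
    finally show ?thesis
      by (simp add: normal_law_def)
  qed
  have "random_data P (x0 \<circ> \<phi>) (\<lambda>k. v k \<circ> \<phi>) (\<lambda>k. \<eta> k \<circ> \<phi>) Qv p"
    unfolding random_data_def x0\<phi> v\<phi> \<eta>\<phi>
  proof (intro conjI allI exI)
    show "prob_space P"
      by (rule P.prob_space_axioms)
    show "gaussian P (\<lambda>f. hx (f Init)) 0 (outer e)"
      unfolding gaussian_def
    proof (intro conjI allI)
      show "psd (outer e)"
        by (intro psdI) (auto simp: transpose_outer outer_mult inner_commute)
      show "(\<lambda>f. hx (f Init)) \<in> borel_measurable P"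
        by (rule measurable_compose[OF coord_borel hx])
      fix a
      have "distr P borel (\<lambda>f. a \<bullet> hx (f Init)) =
          distr (distr P borel (\<lambda>f. f Init $ i)) borel (\<lambda>g. g * (a $ i))"
        using nth_coord by (subst distr_distr) (auto simp: o_def hx_def e_def inner_axis)
      also have "\<dots> = normal_law 0 ((a $ i)\<^sup>2)"
        unfolding law_i by (rule normal_law_scale)
      finally show "distr P borel (\<lambda>f. a \<bullet> hx (f Init)) = normal_law (a \<bullet> 0) (a \<bullet> (outer e *v a))"
        by (simp add: outer_mult e_def inner_axis inner_axis' power2_eq_square)
    qed
    show "gaussian P (\<lambda>f. f (Noise k)) 0 Qv" for k
      using assms(1) coord_borel push[of "\<lambda>x. _ \<bullet> x" "Noise k"]
      by (simp add: gaussian_def D_def L2(3))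
    show "bernoulli P (\<lambda>f. h\<eta> (f (Channel k))) p" for k
    proof -
      have X: "(\<lambda>f. h\<eta> (f (Channel k))) \<in> borel_measurable P"
        by (rule measurable_compose[OF coord_borel h\<eta>])
      have *: "measure P {f \<in> space P. h\<eta> (f (Channel k)) = c} =
          measure (measure_pmf (bernoulli_pmf (1 - p))) {b. (if b then 1 else 0) = c}" for c
      proof -
        have "measure P {f \<in> space P. h\<eta> (f (Channel k)) = c} =
            measure (distr P borel (\<lambda>f. h\<eta> (f (Channel k)))) {c}"
          using X by (subst measure_distr) (auto intro!: arg_cong[where f = "measure P"])
        also have "distr P borel (\<lambda>f. h\<eta> (f (Channel k))) =
            distr (measure_pmf (bernoulli_pmf (1 - p))) borel (\<lambda>b. if b then 1 else 0)"
          unfolding push[OF h\<eta>] D_def source.case LB_def using h\<eta>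
          by (subst distr_distr) (auto simp: o_def h\<eta>_def e_def intro!: distr_cong)
        also have "measure \<dots> {c} = measure (measure_pmf (bernoulli_pmf (1 - p))) {b. (if b then 1 else 0) = c}"
          by (subst measure_distr) (auto intro!: arg_cong[where f = "measure (measure_pmf (bernoulli_pmf (1 - p)))"])
        finally show ?thesis .
      qed
      have "{b. (if b then 1 else 0) = (0 :: real)} = {False}" "{b. (if b then 1 else 0) = (1 :: real)} = {True}"
        by (auto split: if_splits)
      then show ?thesis
        using X assms(2,3) unfolding bernoulli_def * by (simp add: measure_pmf_single)
    qed
    have "P.indep_vars D (\<lambda>s f. f s) UNIV"
      using coord by (subst P.indep_vars_iff_distr_eq_PiM') (simp_all add: coord_law P_def[symmetric] distr_id restrict_UNIV)
    then have ind: "P.indep_sets (\<lambda>s. {(\<lambda>f. f s) -` S \<inter> space P |S. S \<in> sets (D s)}) UNIV"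
      by (simp add: P.indep_vars_def2)
    have ev: "events_of P (\<lambda>f. h (f s)) \<subseteq> {(\<lambda>f. f s) -` S \<inter> space P |S. S \<in> sets (D s)}"
      if h: "h \<in> borel_measurable borel" for h :: "real^'n \<Rightarrow> 'b::topological_space" and s
    proof
      fix T assume "T \<in> events_of P (\<lambda>f. h (f s))"
      then obtain S where S: "S \<in> sets borel" "T = (\<lambda>f. h (f s)) -` S \<inter> space P"
        by (auto simp: events_of_eq)
      then have "h -` S \<in> sets (D s)" "T = (\<lambda>f. f s) -` (h -` S) \<inter> space P"
        using measurable_sets[OF h S(1)] D(2) by auto
      then show "T \<in> {(\<lambda>f. f s) -` S \<inter> space P |S. S \<in> sets (D s)}"
        by blast
    qed
    show "P.indep_sets (\<lambda>s. case s of Init \<Rightarrow> events_of P (\<lambda>f. hx (f Init))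
        | Noise k \<Rightarrow> events_of P (\<lambda>f. f (Noise k)) | Channel k \<Rightarrow> events_of P (\<lambda>f. h\<eta> (f (Channel k)))) UNIV"
    proof (rule P.indep_sets_mono_sets[OF ind])
      fix s
      show "(case s of Init \<Rightarrow> events_of P (\<lambda>f. hx (f Init)) | Noise k \<Rightarrow> events_of P (\<lambda>f. f (Noise k))
          | Channel k \<Rightarrow> events_of P (\<lambda>f. h\<eta> (f (Channel k)))) \<subseteq> {(\<lambda>f. f s) -` S \<inter> space P |S. S \<in> sets (D s)}"
        using ev[OF hx, of s] ev[OF h\<eta>, of s] ev[of "\<lambda>x. x" s] by (cases s) simp_all
    qed
  qed
  then have rd: "random_data (distr P N \<phi>) x0 v \<eta> Qv p"
    using \<phi> meas by (rule random_data_distr)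
  have \<eta>_range: "\<eta> k w \<in> {0, 1}" for k w
    by (simp add: \<eta>_def)
  have x0_axis: "x0 w = x0 w $ i *\<^sub>R axis i 1" for w
    by (simp add: x0_def e_def)
  have pos: "measure (distr P N \<phi>) {w \<in> space (distr P N \<phi>). x0 w $ i \<in> S} > 0"
    if S: "S \<in> sets borel" "emeasure lborel S \<noteq> 0" for S
  proof -
    have "{w \<in> space N. x0 w $ i \<in> S} \<in> sets N"
      using meas(1) S(1) by measurable
    then have "measure (distr P N \<phi>) {w \<in> space (distr P N \<phi>). x0 w $ i \<in> S} =
        measure P (\<phi> -` {w \<in> space N. x0 w $ i \<in> S} \<inter> space P)"
      using \<phi> by (simp add: measure_distr)
    also have "\<phi> -` {w \<in> space N. x0 w $ i \<in> S} \<inter> space P = (\<lambda>f. f Init $ i) -` S \<inter> space P"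
      using measurable_space[OF \<phi>] by (auto simp: x0_def \<phi>_def e_def)
    also have "measure P \<dots> = measure (normal_law 0 1) S"
      using nth_coord[of Init] S(1) law_i by (simp add: measure_distr[symmetric] normal_law_def)
    finally show ?thesis
      using normal_law_pos[OF S] by simp
  qed
  \<comment> \<open>A unit interval inside each half-line witnesses positive Lebesgue
    measure.\<close>
  have "emeasure lborel S \<noteq> 0" if "{a..a + 1} \<subseteq> S" "S \<in> sets borel" for a :: real and S
    using emeasure_mono[of "{a..a + 1}" S lborel] that by auto
  from this[of 1 "{1..}"] this[of "-2" "{..-1}"]
  have "emeasure lborel {1 :: real..} \<noteq> 0" "emeasure lborel {.. -1 :: real} \<noteq> 0"
    by auto
  then have "measure (distr P N \<phi>) {w \<in> space (distr P N \<phi>). x0 w $ i \<ge> 1} > 0"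
    "measure (distr P N \<phi>) {w \<in> space (distr P N \<phi>). x0 w $ i \<le> -1} > 0"
    using pos[of "{1..}"] pos[of "{.. -1}"] by simp_all
  with rd \<eta>_range x0_axis show ?thesis
    by (intro that)
qed

section \<open>From stabilizability to steering\<close>

text \<open>A generated sigma-algebra cannot separate outcomes at which all generators agree.
  Singletons are Borel in a T1 space, so a measurable variable cannot separate them either.\<close>

lemma generated_by_atom:
  fixes X :: "'w \<Rightarrow> 'a::t1_space"
  assumes X: "X \<in> borel_measurable (generated_by M \<X>)"
    and w: "w1 \<in> space M" "w2 \<in> space M" "\<And>Y. Y \<in> \<X> \<Longrightarrow> Y w1 = Y w2"
  shows "X w1 = X w2"
proof -
  have "w1 \<in> S \<longleftrightarrow> w2 \<in> S" if "S \<in> sigma_sets (space M) (\<Union>Y\<in>\<X>. events_of M Y)" for S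
    using that
  proof (induction rule: sigma_sets.induct)
    case (Basic S)
    then obtain Y T where "Y \<in> \<X>" "S = Y -` T \<inter> space M"
      by (auto simp: events_of_eq)
    then show ?case
      using w(3)[of Y] w(1,2) by simp
  qed (use w in auto)
  moreover have "X -` {X w1} \<inter> space M \<in> sets (generated_by M \<X>)"
    using measurable_sets[OF X, of "{X w1}"] by simp
  ultimately have "w2 \<in> X -` {X w1} \<inter> space M"
    using w(1) by (auto simp: sets_generated_by)
  then show ?thesis
    by simp
qed

text \<open>If the bound failed throughout \<open>E\<close>, integrating over \<open>E\<close> would
  already exceed the expectation. The slack \<open>\<delta>\<close> keeps the contradiction strict,
  since the integrals are compared by a weak inequality.\<close>

lemma (in prob_space) event_value_le:
  fixes f :: "'a \<Rightarrow> real"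
  assumes f: "integrable M f" "\<And>w. 0 \<le> f w" and E: "E \<in> events" "prob E > 0" and "\<delta> > 0"
  obtains w where "w \<in> E" "prob E * f w \<le> expectation f + \<delta>"
proof (rule ccontr)
  assume "\<not> thesis"
  then have gt: "expectation f + \<delta> < prob E * f w" if "w \<in> E" for w
    using that \<open>\<And>w. w \<in> E \<Longrightarrow> prob E * f w \<le> expectation f + \<delta> \<Longrightarrow> thesis\<close> by force
  have "((expectation f + \<delta>) / prob E) * indicator E w \<le> f w" for w
    using gt[of w] f(2)[of w] E(2) by (auto simp: indicator_def pos_divide_le_eq mult.commute less_imp_le)
  then have "expectation (\<lambda>w. ((expectation f + \<delta>) / prob E) * indicator E w) \<le> expectation f"
    using E f by (intro integral_mono integrable_mult_right integrable_real_indicator)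
      (auto simp: less_top[symmetric])
  then show False
    using E \<open>\<delta> > 0\<close> by simp
qed

lemma trajectory_scaleR:
  "trajectory A B (\<lambda>k. c *\<^sub>R u k) (c *\<^sub>R x) k = c *\<^sub>R trajectory A B u x k"
  by (induction k) (simp_all add: matrix_vector_mult_scaleR scaleR_add_right)

text \<open>Dividing state and control by \<open>g\<close> starts the trajectory at \<open>x\<close>
  itself and, because \<open>g \<ge> 1\<close>, does not enlarge its norm.\<close>

lemma trajectory_normalize:
  fixes B :: "real^'m^'n"
  assumes "g \<ge> 1"
  shows "\<exists>u'. norm (trajectory A B u' x k) \<le> norm (trajectory A B u (g *\<^sub>R x) k)"
proof
  have "trajectory A B (\<lambda>k. (1 / g) *\<^sub>R u k) x k = (1 / g) *\<^sub>R trajectory A B u (g *\<^sub>R x) k"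
    using trajectory_scaleR[of A B "1 / g" u "g *\<^sub>R x" k] assms by simp
  then show "norm (trajectory A B (\<lambda>k. (1 / g) *\<^sub>R u k) x k) \<le> norm (trajectory A B u (g *\<^sub>R x) k)"
    using assms mult_left_mono[OF assms norm_ge_zero] by (simp add: divide_le_eq)
qed

section \<open>Block vectors and block matrices\<close>

lemma sum_UNIV_Plus:
  fixes f :: "'l::finite + 'r::finite \<Rightarrow> 'b::comm_monoid_add"
  shows "sum f UNIV = (\<Sum>a\<in>UNIV. f (Inl a)) + (\<Sum>b\<in>UNIV. f (Inr b))"
  unfolding UNIV_Plus_UNIV[symmetric] by (subst sum.Plus) (auto simp: o_def)

definition pad_right :: "real^'l \<Rightarrow> real^('l + 'r::finite)" where
  "pad_right y = (\<chi> j. case j of Inl a \<Rightarrow> y $ a | Inr b \<Rightarrow> 0)"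

definition pad_left :: "real^'r \<Rightarrow> real^('l::finite + 'r)" where
  "pad_left y = (\<chi> j. case j of Inl a \<Rightarrow> 0 | Inr b \<Rightarrow> y $ b)"

text \<open>Lets the local correction enter as part of a joint control.\<close>

lemma row_block_pad_right: "row_block BL BR *v pad_right y = BL *v y"
  by (simp add: vec_eq_iff matrix_vector_mult_def row_block_def pad_right_def sum_UNIV_Plus)

lemma diag_block_pad_left: "diag_block P P' *v pad_left y = pad_left (P' *v y)"
  by (auto simp: vec_eq_iff matrix_vector_mult_def diag_block_def pad_left_def sum_UNIV_Plus
      split: sum.split)

lemma inner_pad_left: "pad_left x \<bullet> pad_left y = x \<bullet> y"
  by (simp add: inner_vec_def pad_left_def sum_UNIV_Plus)

lemma pad_left_eq_0: "pad_left y = 0 \<longleftrightarrow> y = 0"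
  by (metis inner_eq_zero_iff inner_pad_left)

lemma posdef_diag_block:
  assumes "posdef P" "posdef P'"
  shows "posdef (diag_block P P')"
proof (rule posdefI)
  show "transpose (diag_block P P') = diag_block P P'"
    using assms by (auto simp: posdef_def vec_eq_iff transpose_def diag_block_def split: sum.split)
  fix x :: "real^('a + 'b)" assume "x \<noteq> 0"
  define y z where "y = (\<chi> a. x $ Inl a)" and "z = (\<chi> b. x $ Inr b)"
  have "x \<bullet> (diag_block P P' *v x) = y \<bullet> (P *v y) + z \<bullet> (P' *v z)"
    by (simp add: y_def z_def inner_vec_def matrix_vector_mult_def diag_block_def sum_UNIV_Plus)
  moreover have "y \<noteq> 0 \<or> z \<noteq> 0"
  proof (rule ccontr)
    assume "\<not> (y \<noteq> 0 \<or> z \<noteq> 0)"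
    then have "x $ j = 0" for j
      by (cases j) (auto simp: y_def z_def vec_eq_iff)
    then show False
      using \<open>x \<noteq> 0\<close> by (simp add: vec_eq_iff)
  qed
  moreover have "0 \<le> y \<bullet> (P *v y)" "0 \<le> z \<bullet> (P' *v z)"
    using assms posdef_imp_psd by (auto simp: psd_def)
  moreover have "y \<noteq> 0 \<Longrightarrow> 0 < y \<bullet> (P *v y)" "z \<noteq> 0 \<Longrightarrow> 0 < z \<bullet> (P' *v z)"
    using assms by (auto simp: posdef_def)
  ultimately show "0 < x \<bullet> (diag_block P P' *v x)"
    by fastforce
qed

text \<open>Turns the universal statement of stabilizability into one concrete stable run for each
  basis direction.\<close>

lemma ms_stabilizable_run:
  fixes A C Qv :: "real^'n^'n" and BL :: "real^'l^'n" and BR :: "real^'r^'n"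
  assumes "psd Qv" and p: "0 \<le> p" "p \<le> 1" and "ms_stabilizable A BL BR C Qv p"
  obtains M :: "'n sample measure" and x0 v \<eta> U uL x yL yR xL xR and K0 K0' :: "real^'n^('l + 'r)"
    where "random_data M x0 v \<eta> Qv p"
    "\<And>w. x0 w = x0 w $ i *\<^sub>R axis i 1"
    "measure M {w \<in> space M. x0 w $ i \<ge> 1} > 0" "measure M {w \<in> space M. x0 w $ i \<le> -1} > 0"
    "system_run A BL BR C M x0 v \<eta> U uL x yL yR xL xR"
    "\<And>k w. U k w = - (K0 *v xR k w) - K0' *v (\<integral>w'. xR k w' \<partial>M)"
    "asymp_ms_stable M x"
proof -
  obtain K0 K0' :: "real^'n^('l + 'r)" and F0 :: "real^'n^'l" where stab:
    "\<And>(M :: 'n sample measure) x0 v \<eta> U uL x yL yR xL xR.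
          random_data M x0 v \<eta> Qv p \<and>
          system_run A BL BR C M x0 v \<eta> U uL x yL yR xL xR \<and>
          (\<forall>w\<in>space M. \<forall>k. U k w = - (K0 *v xR k w) - K0' *v (\<integral>w'. xR k w' \<partial>M)) \<and>
          (\<forall>w\<in>space M. \<forall>k. uL k w = - (F0 *v (xL k w - xR k w))) \<Longrightarrow> asymp_ms_stable M x"
    using assms(4) unfolding ms_stabilizable_def by blast
  obtain M :: "'n sample measure" and x0 v \<eta> where data: "random_data M x0 v \<eta> Qv p"
    "\<And>k w. \<eta> k w \<in> {0, 1}" "\<And>w. x0 w = x0 w $ i *\<^sub>R axis i 1"
    "measure M {w \<in> space M. x0 w $ i \<ge> 1} > 0" "measure M {w \<in> space M. x0 w $ i \<le> -1} > 0"
    using random_data_exists[OF assms(1) p] by blast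
  obtain U uL x yL yR xL xR where run:
    "system_run A BL BR C M x0 v \<eta> U uL x yL yR xL xR"
    "\<And>k w. U k w = - (K0 *v xR k w) - K0' *v (\<integral>w'. xR k w' \<partial>M)"
    "\<And>k w. uL k w = - (F0 *v (xL k w - xR k w))"
    using closed_loop_run_exists[OF data(1,2)] by blast
  have "asymp_ms_stable M x"
    using run by (intro stab[OF conjI[OF data(1)]]) auto
  then show ?thesis
    using that[OF data(1,3,4,5) run(1,2)] by blast
qed

text \<open>While no packet arrives, the remote information is trivial, so the controls \<open>U\<close> coincide on any
  two such outcomes: the difference of the two states is driven by the local control alone.\<close>

lemma ms_stabilizable_imp_steerable:
  fixes A C Qv :: "real^'n^'n" and BL :: "real^'l^'n" and BR :: "real^'r^'n"
  assumes "psd Qv" and p: "0 \<le> p" "p \<le> 1" and stab: "ms_stabilizable A BL BR C Qv p"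
  shows "steerable A (row_block BL BR) 1" "steerable A BL p"
proof -
  have "(\<forall>\<^sub>F N in sequentially. \<exists>u. (norm (trajectory A (row_block BL BR) u (axis i 1) N))\<^sup>2 \<le> \<epsilon>) \<and>
      (\<forall>\<^sub>F N in sequentially. \<exists>u. p ^ N * (norm (trajectory A BL u (axis i 1) N))\<^sup>2 \<le> \<epsilon>)"
    if "\<epsilon> > 0" for i and \<epsilon> :: real
  proof -
    obtain M :: "'n sample measure" and x0 v \<eta> U uL x yL yR xL xR and K0 K0' :: "real^'n^('l + 'r)"
      where rd: "random_data M x0 v \<eta> Qv p"
      and x0: "\<And>w. x0 w = x0 w $ i *\<^sub>R axis i 1"
      and pos: "measure M {w \<in> space M. x0 w $ i \<ge> 1} > 0" "measure M {w \<in> space M. x0 w $ i \<le> -1} > 0"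
      and run: "system_run A BL BR C M x0 v \<eta> U uL x yL yR xL xR"
      and U: "\<And>k w. U k w = - (K0 *v xR k w) - K0' *v (\<integral>w'. xR k w' \<partial>M)"
      and stable: "asymp_ms_stable M x"
      by (rule ms_stabilizable_run[OF assms, of i]) (rule that)
    interpret prob_space M
      using rd by (simp add: random_data_def)
    \<comment> \<open>A lower bound, independent of \<open>N\<close>, for the probabilities of both
      signs of the initial coordinate.\<close>
    define c where "c = min (prob {w \<in> space M. x0 w $ i \<ge> 1}) (prob {w \<in> space M. x0 w $ i \<le> -1})"
    have "c > 0"
      using pos by (simp add: c_def)
    define e where "e N = expectation (\<lambda>w. x N w \<bullet> x N w)" for N
    have int: "integrable M (\<lambda>w. x N w \<bullet> x N w)" for N
      using stable by (simp add: asymp_ms_stable_def)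
    \<comment> \<open>Selected outcomes will satisfy a bound by
      \<open>e N + \<delta> < 2 * \<delta> = \<epsilon> * c / 4\<close>. The quarter is used up when
      two outcomes are subtracted.\<close>
    define \<delta> where "\<delta> = \<epsilon> * c / 8"
    have "\<delta> > 0"
      using \<open>\<epsilon> > 0\<close> \<open>c > 0\<close> by (simp add: \<delta>_def)
    have "e \<longlonglongrightarrow> 0"
      using stable by (simp add: asymp_ms_stable_def e_def[abs_def])
    then have small: "\<forall>\<^sub>F N in sequentially. e N < \<delta>"
      using \<open>\<delta> > 0\<close> by (rule order_tendstoD)
    have x_0: "x 0 w = x0 w" and x_Suc: "x (Suc k) w = A *v x k w + row_block BL BR *v U k w + BL *v uL k w"
      and yR: "yR k w = \<eta> k w *\<^sub>R xL k w" if "w \<in> space M" for k w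
      using run that by (auto simp: system_run_def)
    have xR: "xR k \<in> borel_measurable (generated_by M (yR ` {..k}))" for k
      using run by (simp add: system_run_def is_cond_exp_def remote_info_def)
    define g where "g w = x0 w $ i" for w
    have x0_g: "x0 w = g w *\<^sub>R axis i 1" for w
      unfolding g_def by (rule x0)
    have g_event: "{w \<in> space M. P (g w)} \<in> events_of M x0" if "{t. P t} \<in> sets borel" for P
      using measurable_sets[OF borel_measurable_vec_nth that, of i] unfolding events_of_eq g_def
      by (intro CollectI exI[of _ "(\<lambda>y. y $ i) -` {t. P t}"]) auto
    have g_events: "{w \<in> space M. g w \<ge> 1} \<in> events_of M x0" "{w \<in> space M. g w \<le> -1} \<in> events_of M x0"
      by (intro g_event; simp)+
    have data_sub: "data_events M x0 v \<eta> s \<subseteq> events" for s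
      using random_data_indep_sets[OF rd] by (auto simp: indep_sets_def)
    have c_le: "c \<le> prob {w \<in> space M. g w \<ge> 1}" "c \<le> prob {w \<in> space M. g w \<le> -1}"
      by (auto simp: c_def g_def)
    have "\<exists>u. (norm (trajectory A (row_block BL BR) u (axis i 1) N))\<^sup>2 \<le> \<epsilon>" if "e N < \<delta>" for N
    proof -
      have "{w \<in> space M. g w \<ge> 1} \<in> events"
        using g_events(1) data_sub[of Init] by (auto simp: data_events_def)
      moreover have "prob {w \<in> space M. g w \<ge> 1} > 0"
        using pos(1) by (simp add: g_def)
      ultimately obtain w where w: "w \<in> space M" "g w \<ge> 1"
        "prob {w \<in> space M. g w \<ge> 1} * (x N w \<bullet> x N w) \<le> e N + \<delta>"
        using event_value_le[OF int inner_ge_zero _ _ \<open>\<delta> > 0\<close>, of "{w \<in> space M. g w \<ge> 1}" N]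
        unfolding e_def by blast
      \<comment> \<open>With \<open>w\<close> fixed, the feedback controls are plain sequences and
        the run is an open-loop trajectory.\<close>
      have traj: "x k w = trajectory A (row_block BL BR) (\<lambda>k. U k w + pad_right (uL k w)) (g w *\<^sub>R axis i 1) k" for k
        by (induction k) (simp_all add: x_0 x_Suc w x0_g matrix_vector_right_distrib row_block_pad_right)
      then obtain u where u: "norm (trajectory A (row_block BL BR) u (axis i 1) N) \<le> norm (x N w)"
        using trajectory_normalize[OF w(2), of A "row_block BL BR" "axis i 1" N "\<lambda>k. U k w + pad_right (uL k w)"]
        unfolding traj[symmetric] by blast
      have "c * (norm (x N w))\<^sup>2 \<le> prob {w \<in> space M. g w \<ge> 1} * (x N w \<bullet> x N w)"
        using c_le by (simp add: power2_norm_eq_inner mult_right_mono)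
      also have "\<dots> \<le> c * \<epsilon>"
        using w(3) that \<open>\<delta> > 0\<close> unfolding \<delta>_def by (simp add: mult.commute)
      finally have "(norm (x N w))\<^sup>2 \<le> \<epsilon>"
        using \<open>c > 0\<close> by simp
      then show ?thesis
        using order.trans[OF power_mono[OF u norm_ge_zero]] by blast
    qed
    moreover have "\<exists>u. p ^ N * (norm (trajectory A BL u (axis i 1) N))\<^sup>2 \<le> \<epsilon>" if "e N < \<delta>" "N > 0" for N
    proof (cases "p = 0")
      \<comment> \<open>Losing all packets has probability zero here, but \<open>N > 0\<close> makes
        the discount factor vanish.\<close>
      case True
      then show ?thesis
        using that \<open>\<epsilon> > 0\<close> by (simp add: zero_power)
    next
      case False
      define lost where "lost = {w \<in> space M. \<forall>j<N. \<eta> j w = 0}"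
      \<comment> \<open>The initial state and the first \<open>N\<close> channels are independent;
        the resulting factor \<open>p ^ N\<close> is absorbed by the discount.\<close>
      have lost_prob: "S \<inter> lost \<in> events \<and> prob (S \<inter> lost) = prob S * p ^ N" if S: "S \<in> events_of M x0" for S
      proof -
        define W where "W s = (case s of Init \<Rightarrow> S | Noise k \<Rightarrow> {} | Channel k \<Rightarrow> {w \<in> space M. \<eta> k w = 0})" for s
        let ?J = "insert Init (Channel ` {..<N})"
        have "S \<subseteq> space M"
          using S by (auto simp: events_of_eq)
        then have eq: "S \<inter> lost = (\<Inter>s\<in>?J. W s)"
          using \<open>N > 0\<close> by (auto simp: W_def lost_def)
        have W: "\<forall>s\<in>?J. W s \<in> data_events M x0 v \<eta> s"
          using S by (auto simp: W_def data_events_def events_of_eq intro!: exI[of _ "{0}"])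
        then have "(\<Inter>s\<in>?J. W s) \<in> events"
          using data_sub by (intro sets.finite_INT) auto
        moreover have "prob (\<Inter>s\<in>?J. W s) = (\<Prod>s\<in>?J. prob (W s))"
          using W by (intro indep_setsD[OF random_data_indep_sets[OF rd]]) auto
        moreover have "(\<Prod>s\<in>?J. prob (W s)) = prob S * (\<Prod>k<N. prob (W (Channel k)))"
          by (subst prod.insert) (auto simp: prod.reindex inj_on_def W_def)
        moreover have "prob (W (Channel k)) = p" for k
          using rd by (simp add: random_data_def bernoulli_def W_def)
        ultimately show ?thesis
          by (simp add: eq)
      qed
      have pick: "\<exists>w\<in>S \<inter> lost. p ^ N * (norm (x N w))\<^sup>2 \<le> \<epsilon> / 4"
        if S: "S \<in> events_of M x0" "c \<le> prob S" for S
      proof -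
        have pos': "prob (S \<inter> lost) > 0"
          using lost_prob[OF S(1)] S(2) \<open>c > 0\<close> False p(1) by simp
        obtain w where w: "w \<in> S \<inter> lost" "prob (S \<inter> lost) * (x N w \<bullet> x N w) \<le> e N + \<delta>"
          using event_value_le[OF int inner_ge_zero _ _ \<open>\<delta> > 0\<close>, of "S \<inter> lost" N] lost_prob[OF S(1)] pos'
        unfolding e_def by blast
        have "c * (p ^ N * (norm (x N w))\<^sup>2) \<le> prob S * (p ^ N * (norm (x N w))\<^sup>2)"
          using S p by (intro mult_right_mono) auto
        also have "\<dots> = prob (S \<inter> lost) * (x N w \<bullet> x N w)"
          using lost_prob[OF S(1)] by (simp add: power2_norm_eq_inner)
        also have "\<dots> \<le> c * (\<epsilon> / 4)"
          using w(2) \<open>e N < \<delta>\<close> unfolding \<delta>_def by (simp add: mult.commute)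
        finally show ?thesis
          using w(1) \<open>c > 0\<close> by (intro bexI[of _ w]) simp_all
      qed
      obtain w1 where w1: "w1 \<in> space M" "g w1 \<ge> 1" "\<forall>j<N. \<eta> j w1 = 0"
        "p ^ N * (norm (x N w1))\<^sup>2 \<le> \<epsilon> / 4"
        using pick[OF g_events(1) c_le(1)] by (auto simp: lost_def)
      obtain w2 where w2: "w2 \<in> space M" "g w2 \<le> -1" "\<forall>j<N. \<eta> j w2 = 0"
        "p ^ N * (norm (x N w2))\<^sup>2 \<le> \<epsilon> / 4"
        using pick[OF g_events(2) c_le(2)] by (auto simp: lost_def)
      \<comment> \<open>Before time \<open>N\<close> both outcomes deliver only zero packets, so the
        remote information cannot tell them apart.\<close>
      have "xR k w1 = xR k w2" if "k < N" for k
        using that w1 w2 by (intro generated_by_atom[OF xR]) (auto simp: yR)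
      then have U_eq: "U k w1 = U k w2" if "k < N" for k
        using that by (simp add: U)
      have traj: "x k w1 - x k w2 = trajectory A BL (\<lambda>k. uL k w1 - uL k w2) ((g w1 - g w2) *\<^sub>R axis i 1) k"
        if "k \<le> N" for k
        using that
      proof (induction k)
        case 0
        then show ?case
          using w1 w2 by (simp add: x_0 x0_g scaleR_diff_left)
      next
        case (Suc k)
        then show ?case
          using w1 w2 by (simp add: x_Suc U_eq matrix_vector_mult_diff_distrib flip: Suc.IH)
      qed
      \<comment> \<open>Opposite signs keep the initial difference away from zero; it is even at
        least 2.\<close>
      have "g w1 - g w2 \<ge> 1"
        using w1 w2 by simp
      from trajectory_normalize[OF this, of A BL "axis i 1" N "\<lambda>k. uL k w1 - uL k w2"]
      obtain u where u: "norm (trajectory A BL u (axis i 1) N) \<le> norm (x N w1 - x N w2)"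
        unfolding traj[OF order.refl, symmetric] by blast
      have "(norm (trajectory A BL u (axis i 1) N))\<^sup>2 \<le> (norm (x N w1 - x N w2))\<^sup>2"
        by (rule power_mono[OF u norm_ge_zero])
      also have "\<dots> \<le> 2 * (norm (x N w1))\<^sup>2 + 2 * (norm (x N w2))\<^sup>2"
        using power_mono[OF norm_triangle_ineq4 norm_ge_zero, of "x N w1" "x N w2" 2]
          sum_squares_bound[of "norm (x N w1)" "norm (x N w2)"]
        by (simp add: power2_sum)
      finally have "p ^ N * (norm (trajectory A BL u (axis i 1) N))\<^sup>2
          \<le> p ^ N * (2 * (norm (x N w1))\<^sup>2 + 2 * (norm (x N w2))\<^sup>2)"
        using p by (intro mult_left_mono) auto
      also have "\<dots> \<le> \<epsilon>"
        using w1(4) w2(4) by (simp add: algebra_simps)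
      finally show ?thesis
        by blast
    qed
    ultimately show ?thesis
      by (intro conjI eventually_mono[OF small] eventually_elim2[OF small eventually_gt_at_top[of 0]])
  qed
  then show "steerable A (row_block BL BR) 1" "steerable A BL p"
    unfolding steerable_def by simp_all
qed

text \<open>Only initial states in the second block of the doubled system are considered, where the
  weight is \<open>Q\<close>. The squared norm of \<open>T *v pad_left y\<close> is the form of
  \<open>Q\<close> at \<open>y\<close>, so a vanishing form means zero output.\<close>

lemma observable_quadratic_form:
  fixes A :: "real^'n^'n"
  assumes "is_psd_sqrt T (diag_block P Q)" "observable (diag_block A A) T" "x \<noteq> 0"
  shows "\<exists>k. ((*v) A ^^ k) x \<bullet> (Q *v ((*v) A ^^ k) x) \<noteq> 0"
proof (rule ccontr)
  assume *: "\<not> ?thesis"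
  have pow: "((*v) (diag_block A A) ^^ k) (pad_left y) = pad_left (((*v) A ^^ k) y)" for k y
    by (induction k) (simp_all add: diag_block_pad_left)
  have "T *v pad_left y = 0" if "y \<bullet> (Q *v y) = 0" for y
  proof -
    have "(T *v pad_left y) \<bullet> (T *v pad_left y) = pad_left y \<bullet> (transpose T *v (T *v pad_left y))"
      by (rule inner_transpose(1)[symmetric])
    also have "\<dots> = pad_left y \<bullet> (diag_block P Q *v pad_left y)"
      using assms(1) by (simp only: is_psd_sqrt_def psd_def matrix_vector_mul_assoc)
    also have "\<dots> = 0"
      using that by (simp add: diag_block_pad_left inner_pad_left)
    finally show ?thesis
      by simp
  qed
  then have "T *v (((*v) (diag_block A A) ^^ k) (pad_left x)) = T *v (((*v) (diag_block A A) ^^ k) (pad_left 0))" for k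
  proof -
    have "((*v) A ^^ k) 0 = 0"
      by (induction k) simp_all
    then show ?thesis
      using * \<open>\<And>y. y \<bullet> (Q *v y) = 0 \<Longrightarrow> T *v pad_left y = 0\<close> by (simp add: pow pad_left_eq_0)
  qed
  then have "(\<lambda>k. T *v (((*v) (diag_block A A) ^^ k) (pad_left x))) =
      (\<lambda>k. T *v (((*v) (diag_block A A) ^^ k) (pad_left 0)))"
    by (rule ext)
  then have "pad_left x = (pad_left 0 :: real^('n + 'n))"
    by (rule injD[OF assms(2)[unfolded observable_def]])
  then show False
    using assms(3) pad_left_eq_0 by metis
qed

section \<open>Assembling the coupled solutions\<close>

lemma Theta_1 [simp]: "Theta 1 Z X = X"
  by (simp add: Theta_def)

text \<open>Both \<open>K_gain\<close> factors contain the inverse \<open>V\<close> of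
  \<open>Upsilon B R Z\<close>, and \<open>V ** Upsilon B R Z ** V = V\<close> leaves a single
  one.\<close>

lemma riccati_gain:
  assumes "psd Z" "posdef R"
  shows "riccati A B G R Z = transpose A ** Z ** A + G
      - transpose (K_gain A B R Z) ** Upsilon B R Z ** K_gain A B R Z"
proof -
  have U: "posdef (Upsilon B R Z)"
    using posdef_Lambda[OF assms, of B] by (simp add: Upsilon_def Lambda_def)
  then have inv: "transpose (matrix_inv (Upsilon B R Z)) = matrix_inv (Upsilon B R Z)"
    by (intro transpose_matrix_inv posdef_invertible) (simp_all add: posdef_def)
  let ?V = "matrix_inv (Upsilon B R Z)"
  have "?V ** Upsilon B R Z ** ?V = ?V"
    unfolding matrix_eq by (simp add: matrix_vector_mul_assoc[symmetric] matrix_inv_mult posdef_invertible U)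
  then have "Y ** ?V ** Upsilon B R Z ** ?V = Y ** ?V" for Y :: "real^_^'a"
    unfolding matrix_mul_assoc[symmetric] by simp
  then show ?thesis
    by (simp add: riccati_def K_gain_def L_mat_def matrix_transpose_mul inv matrix_mul_assoc
        Lambda_def[of B R Z, folded Upsilon_def])
qed

theorem lemma4:
  fixes A C Q Qv :: "real^'n^'n"
    and BL :: "real^'l^'n" and BR :: "real^'r^'n"
    and RL :: "real^'l^'l" and RR :: "real^'r^'r"
    and D :: "real^('n + 'n)^'d"
    and sqrtQQ :: "real^('n + 'n)^('n + 'n)"
    and \<mu> p :: real
  defines "B \<equiv> row_block BL BR"
    and "R \<equiv> diag_block RL RR"
    and "Q\<^sub>\<mu> \<equiv> Q + \<mu> *\<^sub>R Q"
  assumes "0 \<le> \<mu>" and "0 \<le> p" and "p \<le> 1"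
    and "psd Qv" and "psd Q"
    and "posdef RL" and "posdef RR"
    and "diag_block Q\<^sub>\<mu> Q = transpose D ** D"
    and "psd (diag_block Q\<^sub>\<mu> Q)"
    and "is_psd_sqrt sqrtQQ (diag_block Q\<^sub>\<mu> Q)"
    and "observable (diag_block A A) sqrtQQ"
    and "detectable A C"
    and "ms_stabilizable A BL BR C Qv p"
  shows "\<exists>Z X S :: real^'n^'n.
      Z = transpose A ** Z ** A + Q\<^sub>\<mu>
            - transpose (K_gain A B R Z) ** Upsilon B R Z ** K_gain A B R Z \<and>
      X = transpose A ** Theta p Z X ** A + Q\<^sub>\<mu>
            - transpose (L_mat A BL (Theta p Z X)) ** matrix_inv (Lambda BL RL (Theta p Z X))
              ** L_mat A BL (Theta p Z X) \<and>
      S = transpose A ** S ** A - \<mu> *\<^sub>R Q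
            + transpose (K_gain A B R Z) ** Upsilon B R Z ** K_gain A B R Z
            - transpose (N_mat A B Z S) ** matrix_inv (M_mat B R Z S) ** N_mat A B Z S \<and>
      posdef Z \<and> posdef (Z + S) \<and> posdef (Theta p Z X)"
proof -
  have steer: "steerable A B 1" "steerable A BL p"
    unfolding B_def using ms_stabilizable_imp_steerable assms by blast+
  have R: "posdef R"
    unfolding R_def using assms by (intro posdef_diag_block)
  have Q\<mu>: "psd Q\<^sub>\<mu>"
    unfolding Q\<^sub>\<mu>_def using assms by (intro psd_add psd_scaleR)
  have Q\<mu>_form: "x \<bullet> (Q\<^sub>\<mu> *v x) = (1 + \<mu>) * (x \<bullet> (Q *v x))" for x
    by (simp add: Q\<^sub>\<mu>_def matrix_vector_mult_add_rdistrib inner_add_right matrix_scaleR_vector algebra_simps)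
  have obs: "\<exists>k. ((*v) A ^^ k) x \<bullet> (Q *v ((*v) A ^^ k) x) \<noteq> 0" if "x \<noteq> 0" for x
    using observable_quadratic_form assms that by blast
  \<comment> \<open>The weight \<open>Q\<^sub>\<mu>\<close> is the positive multiple
    \<open>1 + \<mu>\<close> of \<open>Q\<close>, so its form vanishes at the same states.\<close>
  then have obs\<mu>: "\<exists>k. ((*v) A ^^ k) x \<bullet> (Q\<^sub>\<mu> *v ((*v) A ^^ k) x) \<noteq> 0" if "x \<noteq> 0" for x
    using that \<open>0 \<le> \<mu>\<close> by (auto simp: Q\<mu>_form)
  \<comment> \<open>With discount 1 the weight \<open>Theta\<close> reduces to the unknown itself,
    so the zero matrix can stand in for the known one.\<close>
  obtain Z where Z: "psd Z" "Z = riccati A B Q\<^sub>\<mu> R Z"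
    using riccati_solvable[OF steer(1) zero_le_one order.refl Q\<mu> R psd_zero, unfolded Theta_1] by blast
  obtain W where W: "psd W" "W = riccati A B Q R W"
    using riccati_solvable[OF steer(1) zero_le_one order.refl \<open>psd Q\<close> R psd_zero, unfolded Theta_1] by blast
  obtain X where X: "psd X" "X = riccati A BL Q\<^sub>\<mu> RL (Theta p Z X)"
    using riccati_solvable[OF steer(2) \<open>0 \<le> p\<close> \<open>p \<le> 1\<close> Q\<mu> \<open>posdef RL\<close> Z(1)] by blast
  have Z_pos: "posdef Z"
    using Z Q\<mu> R obs\<mu> by (rule riccati_posdef)
  have W_pos: "posdef W"
    using W \<open>psd Q\<close> R obs by (rule riccati_posdef)
  have Theta_pos: "posdef (Theta p Z X)"
  proof (cases "p = 1")
    case True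
    have "X = riccati A BL Q\<^sub>\<mu> RL X"
      using X(2) unfolding True Theta_1 .
    then show ?thesis
      unfolding True Theta_1 using Q\<mu> \<open>posdef RL\<close> obs\<mu> by (rule riccati_posdef[OF X(1)])
  next
    case False
    then show ?thesis
      using Z_pos X(1) \<open>0 \<le> p\<close> \<open>p \<le> 1\<close>
      by (auto simp: Theta_def posdef_def psd_def transpose_add transpose_scaleR
          matrix_vector_mult_add_rdistrib inner_add_right matrix_scaleR_vector intro!: add_pos_nonneg)
  qed
  note Z_eq = Z(2)[unfolded riccati_gain[OF Z(1) R]]
  define S where "S = W - Z"
  \<comment> \<open>Both matrices depend on \<open>Z\<close> and \<open>S\<close> only through their
    sum \<open>W\<close>.\<close>
  have "M_mat B R Z S = Lambda B R W" "N_mat A B Z S = L_mat A B W"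
    unfolding M_mat_def N_mat_def Lambda_def L_mat_def S_def matrix_eq
    by (simp_all add: matrix_vector_mul_assoc[symmetric] matrix_vector_mult_diff_rdistrib
        matrix_vector_mult_diff_distrib matrix_vector_mult_add_rdistrib)
  moreover have "transpose A ** S ** A = transpose A ** W ** A - transpose A ** Z ** A"
    unfolding S_def matrix_eq
    by (simp add: matrix_vector_mul_assoc[symmetric] matrix_vector_mult_diff_rdistrib matrix_vector_mult_diff_distrib)
  \<comment> \<open>Subtracting the two equations leaves \<open>- \<mu> *\<^sub>R Q\<close> from the
    weights and returns the gain term of \<open>Z\<close> with a positive sign.\<close>
  moreover have "W - Z = b - a - m + k - n"
    if "Z = a + (Q + m) - k" "W = b + Q - n" for a b k m n :: "real^'n^'n"
    unfolding that by simp
  note this[OF Z_eq[unfolded Q\<^sub>\<mu>_def] W(2)[unfolded riccati_def]]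
  ultimately have "S = transpose A ** S ** A - \<mu> *\<^sub>R Q
      + transpose (K_gain A B R Z) ** Upsilon B R Z ** K_gain A B R Z
      - transpose (N_mat A B Z S) ** matrix_inv (M_mat B R Z S) ** N_mat A B Z S"
    by (simp only: S_def)
  moreover have "posdef (Z + S)"
    using W_pos by (simp add: S_def)
  ultimately show ?thesis
    using Z_eq X(2)[unfolded riccati_def] Z_pos Theta_pos by blast
qed

end
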